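(* Let $n$ be a nonnegative integer, let $\theta_0,\dots,\theta_n$ be nonconstant inner functions, and let $T=\bigoplus_{j=0}^nS(\theta_j)$. Then the algebra $H^\infty(T)=\{u(T):u\in H^\infty\}$ has the closability property.
   Context: $S$ is the unilateral shift (multiplication by $z$) on $H^2$. For an inner function $\theta$, $\mathcal{H}(\theta)=H^2\ominus\theta H^2$, $S(\theta)$ is defined by $S(\theta)^*=S^*|\mathcal{H}(\theta)$, and for $u\in H^\infty$, $u(S(\theta))=P_{\mathcal{H}(\theta)}u(S)|\mathcal{H}(\theta)$, where $u(S)$ is multiplication by $u$; $u(T)=\bigoplus_j u(S(\theta_j))$. A linear transformation $X$ commutes with an algebra $\mathcal{A}$ if its domain is dense and $\mathcal{A}$-invariant and $XA=AX$ on its domain for all $A\in\mathcal{A}$; a unital algebra has the closability property if every densely defined linear transformation commuting with it is closable (the closure of its graph is a graph). *)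

theory Defs
  imports "HOL-Analysis.Analysis"
begin

definition disc :: "complex set" where "disc = ball 0 1"

definition tcoeff :: "(complex \<Rightarrow> complex) \<Rightarrow> nat \<Rightarrow> complex" where
  "tcoeff f k = (deriv ^^ k) f 0 / of_nat (fact k)"

definition H2 :: "(complex \<Rightarrow> complex) set" where
  "H2 = {f. f holomorphic_on disc \<and> (\<forall>z. z \<notin> disc \<longrightarrow> f z = 0)
            \<and> summable (\<lambda>k. (cmod (tcoeff f k))\<^sup>2)}"

definition h2_inner :: "(complex \<Rightarrow> complex) \<Rightarrow> (complex \<Rightarrow> complex) \<Rightarrow> complex" where
  "h2_inner f g = (\<Sum>k. tcoeff f k * cnj (tcoeff g k))"

definition h2_norm :: "(complex \<Rightarrow> complex) \<Rightarrow> real" where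
  "h2_norm f = sqrt (\<Sum>k. (cmod (tcoeff f k))\<^sup>2)"

definition Hinf :: "(complex \<Rightarrow> complex) set" where
  "Hinf = {u. u holomorphic_on disc \<and> bounded (u ` disc)}"

definition inner_fn :: "(complex \<Rightarrow> complex) \<Rightarrow> bool" where
  "inner_fn \<theta> \<longleftrightarrow> \<theta> \<in> Hinf \<and>
     (AE t in lborel. t \<in> {0..2*pi} \<longrightarrow>
        (\<exists>c. cmod c = 1 \<and> ((\<lambda>r::real. \<theta> (complex_of_real r * cis t)) \<longlongrightarrow> c) (at_left 1)))"

definition nonconstant_on_disc :: "(complex \<Rightarrow> complex) \<Rightarrow> bool" where
  "nonconstant_on_disc \<theta> \<longleftrightarrow> \<not> (\<exists>c. \<forall>z\<in>disc. \<theta> z = c)"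

definition model_space :: "(complex \<Rightarrow> complex) \<Rightarrow> (complex \<Rightarrow> complex) set" where
  "model_space \<theta> = {f \<in> H2. \<forall>g\<in>H2. h2_inner f (\<lambda>z. \<theta> z * g z) = 0}"

definition h2_proj :: "(complex \<Rightarrow> complex) set \<Rightarrow> (complex \<Rightarrow> complex) \<Rightarrow> (complex \<Rightarrow> complex)" where
  "h2_proj K f = (THE p. p \<in> K \<and> (\<forall>k\<in>K. h2_inner (\<lambda>z. f z - p z) k = 0))"

text \<open>\<open>u(S(\<theta>)) = P_{\<H>(\<theta>)} u(S) |\<H>(\<theta>)\<close>.\<close>
definition uS :: "(complex \<Rightarrow> complex) \<Rightarrow> (complex \<Rightarrow> complex) \<Rightarrow> (complex \<Rightarrow> complex) \<Rightarrow> (complex \<Rightarrow> complex)" where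
  "uS \<theta> u f = h2_proj (model_space \<theta>) (\<lambda>z. u z * f z)"

type_synonym vec = "nat \<Rightarrow> complex \<Rightarrow> complex"

definition DS :: "nat \<Rightarrow> (nat \<Rightarrow> complex \<Rightarrow> complex) \<Rightarrow> vec set" where
  "DS n \<theta> = {x. (\<forall>j\<le>n. x j \<in> model_space (\<theta> j)) \<and> (\<forall>j. n < j \<longrightarrow> x j = (\<lambda>z. 0))}"

definition ds_norm :: "nat \<Rightarrow> vec \<Rightarrow> real" where
  "ds_norm n x = sqrt (\<Sum>j\<le>n. (h2_norm (x j))\<^sup>2)"

definition uT :: "nat \<Rightarrow> (nat \<Rightarrow> complex \<Rightarrow> complex) \<Rightarrow> (complex \<Rightarrow> complex) \<Rightarrow> vec \<Rightarrow> vec" where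
  "uT n \<theta> u x = (\<lambda>j. if j \<le> n then uS (\<theta> j) u (x j) else (\<lambda>z. 0))"

definition vzero :: vec where "vzero = (\<lambda>j z. 0)"
definition vadd :: "vec \<Rightarrow> vec \<Rightarrow> vec" where "vadd x y = (\<lambda>j z. x j z + y j z)"
definition vsub :: "vec \<Rightarrow> vec \<Rightarrow> vec" where "vsub x y = (\<lambda>j z. x j z - y j z)"
definition vsmul :: "complex \<Rightarrow> vec \<Rightarrow> vec" where "vsmul c x = (\<lambda>j z. c * x j z)"

definition lin_transf :: "vec set \<Rightarrow> vec set \<Rightarrow> (vec \<Rightarrow> vec) \<Rightarrow> bool" where
  "lin_transf H D X \<longleftrightarrow> D \<subseteq> H \<and> vzero \<in> D \<and>
     (\<forall>x\<in>D. \<forall>y\<in>D. vadd x y \<in> D) \<and> (\<forall>c. \<forall>x\<in>D. vsmul c x \<in> D) \<and>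
     (\<forall>x\<in>D. X x \<in> H) \<and>
     (\<forall>x\<in>D. \<forall>y\<in>D. X (vadd x y) = vadd (X x) (X y)) \<and>
     (\<forall>c. \<forall>x\<in>D. X (vsmul c x) = vsmul c (X x))"

definition dense_in :: "vec set \<Rightarrow> (vec \<Rightarrow> real) \<Rightarrow> vec set \<Rightarrow> bool" where
  "dense_in H N D \<longleftrightarrow> (\<forall>x\<in>H. \<forall>e>0. \<exists>d\<in>D. N (vsub x d) < e)"

definition commutes_with :: "vec set \<Rightarrow> (vec \<Rightarrow> real) \<Rightarrow> (vec \<Rightarrow> vec) set \<Rightarrow> vec set \<Rightarrow> (vec \<Rightarrow> vec) \<Rightarrow> bool" where
  "commutes_with H N \<A> D X \<longleftrightarrow> dense_in H N D \<and>
     (\<forall>A\<in>\<A>. \<forall>x\<in>D. A x \<in> D \<and> X (A x) = A (X x))"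

definition graph_closure :: "vec set \<Rightarrow> (vec \<Rightarrow> real) \<Rightarrow> vec set \<Rightarrow> (vec \<Rightarrow> vec) \<Rightarrow> (vec \<times> vec) set" where
  "graph_closure H N D X = {(x, y). x \<in> H \<and> y \<in> H \<and>
     (\<exists>s. (\<forall>k. s k \<in> D) \<and> (\<lambda>k. N (vsub (s k) x)) \<longlonglongrightarrow> 0 \<and> (\<lambda>k. N (vsub (X (s k)) y)) \<longlonglongrightarrow> 0)}"

definition closable :: "vec set \<Rightarrow> (vec \<Rightarrow> real) \<Rightarrow> vec set \<Rightarrow> (vec \<Rightarrow> vec) \<Rightarrow> bool" where
  "closable H N D X \<longleftrightarrow>
     (\<forall>x y y'. (x, y) \<in> graph_closure H N D X \<and> (x, y') \<in> graph_closure H N D X \<longrightarrow> y = y')"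

definition closability_property :: "vec set \<Rightarrow> (vec \<Rightarrow> real) \<Rightarrow> (vec \<Rightarrow> vec) set \<Rightarrow> bool" where
  "closability_property H N \<A> \<longleftrightarrow>
     (\<forall>D X. lin_transf H D X \<and> commutes_with H N \<A> D X \<longrightarrow> closable H N D X)"

end

theory Submission
  imports Defs "HOL-Complex_Analysis.Complex_Analysis" "Jordan_Normal_Form.Determinant"
begin

text \<open>Suppose \<open>X\<close> commutes with the algebra and is defined on the dense set \<open>D\<close>. If \<open>c\<^sub>0, \<dots>, c\<^sub>n \<in> D\<close> lift,
  modulo the spaces \<open>\<theta>\<^sub>j H\<^sup>2\<close>, to the rows of a matrix \<open>A\<close> with \<open>H\<^sup>\<infinity>\<close> entries, then Cramer's rule expresses
  \<open>(det A)(T) x\<close>, for \<open>x \<in> D\<close>, through the \<open>c\<^sub>i\<close>. Applying \<open>X\<close> writes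
  \<open>(det A)(T) (X x)\<close> in terms of the fixed vectors \<open>X c\<^sub>i\<close>, up to
  multipliers depending continuously on \<open>x\<close>; so two limits \<open>y, y'\<close> of \<open>X x\<^sub>l\<close> along sequences with the same
  limit \<open>x\<^sub>l \<longrightarrow> x\<close> satisfy \<open>(det A)(T) y = (det A)(T) y'\<close>. Density of \<open>D\<close> provides matrices that are uniformly
  bounded and tend to the identity, and then \<open>det A \<longrightarrow> 1\<close> boundedly, whence \<open>y = y'\<close>.

  Unbounded \<open>H\<^sup>2\<close> functions \<open>f\<close> are made bounded without boundary values or outer functions: if \<open>F\<close> is holomorphic
  with \<open>|f|\<^sup>2 \<le> Re F\<close>, then the multipliers \<open>1 / (1 + F/s)\<close> are bounded by 1, make \<open>f\<close> bounded,
  and tend to 1 as \<open>s \<longrightarrow> \<infinity>\<close>.\<close>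

section \<open>Taylor coefficients and the Hardy space\<close>

text \<open>Three families of \<open>H2\<close> functions have to be made bounded: the components of
  \<open>x\<close>, so that the coefficients in Cramer's rule are admissible multipliers; the
  components of the \<open>X (c i)\<close>, so that after regrouping they become bounded
  coefficients of \<open>x\<close> and the formula survives limits; and the distances of vectors of
  \<open>D\<close> from the constant unit vectors, so that the matrix entries lie in
  \<open>Hinf\<close>. The first two multipliers are removed again by letting s tend to infinity.
  The third stays, with s = 1: its majorant is itself small, so it is already close to 1. A single
  matrix does not give y = y', because det A may share an inner factor with some \<theta> and det
  A(T) may then have a kernel. A sequence of determinants tending to 1 is used instead. Weak
  convergence suffices, since vectors of a model space are compared by their inner products with its
  elements. The radial limits of \<theta> serve to show that multiplication by \<theta> is isometric
  on \<open>H2\<close>; the orthogonal projection onto \<theta> \<open>H2\<close> is then written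
  down explicitly.\<close>

lemma mem_disc: "z \<in> disc \<longleftrightarrow> cmod z < 1"
  by (simp add: disc_def)

lemma open_disc: "open disc"
  by (simp add: disc_def)

lemma zero_in_disc: "0 \<in> disc"
  by (simp add: disc_def)

lemma sums_tcoeff:
  assumes "f holomorphic_on disc" "z \<in> disc"
  shows "(\<lambda>k. tcoeff f k * z ^ k) sums f z"
  using holomorphic_power_series[of f 0 1 z] assms by (simp add: disc_def tcoeff_def)

text \<open>A series summable at 1/2 has positive radius of convergence and so is the expansion of f
  at 0. This replaces iterated derivatives in the computation of coefficients.\<close>

lemma tcoeff_powser:
  assumes "\<And>z. z \<in> disc \<Longrightarrow> (\<lambda>k. a k * z ^ k) sums f z"
  shows "tcoeff f k = a k"
proof -
  define F where "F = Abs_fps a"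
  have s: "summable (\<lambda>k. a k * (1/2) ^ k)"
    using assms[of "1/2"] by (auto simp: mem_disc sums_iff)
  have "ereal (norm (1/2::complex)) \<le> conv_radius a"
    using conv_radius_geI[OF s] .
  moreover have "(0::ereal) < ereal (norm (1/2::complex))" by simp
  ultimately have "conv_radius a > 0"
    by (rule less_le_trans[rotated])
  hence pos: "fps_conv_radius F > 0"
    by (simp add: F_def fps_conv_radius_def Abs_fps_inverse)
  have ev: "eventually (\<lambda>z. eval_fps F z = f z) (nhds 0)"
  proof -
    have "eventually (\<lambda>z. z \<in> disc) (nhds 0)"
      using open_disc zero_in_disc by (rule eventually_nhds_in_open)
    thus ?thesis
      by eventually_elim (use assms in \<open>auto simp: eval_fps_def F_def sums_iff\<close>)
  qed
  have "f has_fps_expansion F"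
    unfolding has_fps_expansion_def using pos ev by simp
  from fps_nth_fps_expansion[OF this, of k] show ?thesis
    by (simp add: F_def tcoeff_def)
qed

lemma tcoeff_add:
  assumes "f holomorphic_on disc" "g holomorphic_on disc"
  shows "tcoeff (\<lambda>z. f z + g z) k = tcoeff f k + tcoeff g k"
  by (rule tcoeff_powser) (use sums_add[OF sums_tcoeff[OF assms(1)] sums_tcoeff[OF assms(2)]] in
      \<open>simp add: algebra_simps\<close>)

lemma tcoeff_cmult:
  assumes "f holomorphic_on disc"
  shows "tcoeff (\<lambda>z. c * f z) k = c * tcoeff f k"
  by (rule tcoeff_powser) (use sums_mult[OF sums_tcoeff[OF assms(1)], of _ c] in
      \<open>simp add: algebra_simps\<close>)

lemma summable_sq_mult:
  fixes a b :: "nat \<Rightarrow> complex"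
  assumes "summable (\<lambda>k. (cmod (a k))\<^sup>2)" "summable (\<lambda>k. (cmod (b k))\<^sup>2)"
  shows "summable (\<lambda>k. cmod (a k) * cmod (b k))"
proof (rule summable_comparison_test')
  show "summable (\<lambda>k. (cmod (a k))\<^sup>2 + (cmod (b k))\<^sup>2)"
    by (intro summable_add assms)
  show "norm (cmod (a k) * cmod (b k)) \<le> (cmod (a k))\<^sup>2 + (cmod (b k))\<^sup>2" for k
  proof -
    have "0 \<le> cmod (a k) * cmod (b k)" by simp
    thus ?thesis using sum_squares_bound[of "cmod (a k)" "cmod (b k)"] unfolding real_norm_def by linarith
  qed
qed

lemma summable_sq_cnj:
  fixes a b :: "nat \<Rightarrow> complex"
  assumes "summable (\<lambda>k. (cmod (a k))\<^sup>2)" "summable (\<lambda>k. (cmod (b k))\<^sup>2)"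
  shows "summable (\<lambda>k. a k * cnj (b k))"
  by (rule summable_norm_cancel) (use summable_sq_mult[OF assms] in \<open>simp add: norm_mult\<close>)

lemma Cauchy_Schwarz_suminf:
  fixes a b :: "nat \<Rightarrow> complex"
  assumes "summable (\<lambda>k. (cmod (a k))\<^sup>2)" "summable (\<lambda>k. (cmod (b k))\<^sup>2)"
  shows "cmod (\<Sum>k. a k * cnj (b k)) \<le> sqrt (\<Sum>k. (cmod (a k))\<^sup>2) * sqrt (\<Sum>k. (cmod (b k))\<^sup>2)"
proof -
  have "cmod (\<Sum>k. a k * cnj (b k)) \<le> (\<Sum>k. cmod (a k) * cmod (b k))"
    using summable_norm[of "\<lambda>k. a k * cnj (b k)"] summable_sq_mult[OF assms]
    by (simp add: norm_mult)
  also have "\<dots> \<le> sqrt (\<Sum>k. (cmod (a k))\<^sup>2) * sqrt (\<Sum>k. (cmod (b k))\<^sup>2)"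
  proof (rule suminf_le_const[OF summable_sq_mult[OF assms]])
    fix n
    have "(\<Sum>k<n. cmod (a k) * cmod (b k)) \<le> L2_set (\<lambda>k. cmod (a k)) {..<n} * L2_set (\<lambda>k. cmod (b k)) {..<n}"
      using L2_set_mult_ineq[of "\<lambda>k. cmod (a k)" "\<lambda>k. cmod (b k)" "{..<n}"] by simp
    also have "\<dots> \<le> sqrt (\<Sum>k. (cmod (a k))\<^sup>2) * sqrt (\<Sum>k. (cmod (b k))\<^sup>2)"
      unfolding L2_set_def
      by (intro mult_mono real_sqrt_le_mono sum_le_suminf assms)
         (auto intro!: suminf_nonneg sum_nonneg assms)
    finally show "(\<Sum>k<n. cmod (a k) * cmod (b k)) \<le> sqrt (\<Sum>k. (cmod (a k))\<^sup>2) * sqrt (\<Sum>k. (cmod (b k))\<^sup>2)" .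
  qed
  finally show ?thesis .
qed

lemma H2_holomorphic: "f \<in> H2 \<Longrightarrow> f holomorphic_on disc"
  by (simp add: H2_def)

lemma H2_summable: "f \<in> H2 \<Longrightarrow> summable (\<lambda>k. (cmod (tcoeff f k))\<^sup>2)"
  by (simp add: H2_def)

lemma H2_outside: "f \<in> H2 \<Longrightarrow> z \<notin> disc \<Longrightarrow> f z = 0"
  by (simp add: H2_def)

lemma H2_eqI:
  assumes "f \<in> H2" "g \<in> H2" "\<And>k. tcoeff f k = tcoeff g k"
  shows "f = g"
proof
  fix z show "f z = g z"
    using sums_tcoeff[OF H2_holomorphic[OF assms(1)], of z] sums_tcoeff[OF H2_holomorphic[OF assms(2)], of z]
      H2_outside[OF assms(1), of z] H2_outside[OF assms(2), of z] assms(3)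
    by (cases "z \<in> disc") (auto intro: sums_unique2)
qed

lemma H2_add:
  assumes "f \<in> H2" "g \<in> H2"
  shows "(\<lambda>z. f z + g z) \<in> H2"
proof -
  have "summable (\<lambda>k. (cmod (tcoeff f k + tcoeff g k))\<^sup>2)"
  proof (rule summable_comparison_test')
    show "summable (\<lambda>k. 2 * (cmod (tcoeff f k))\<^sup>2 + 2 * (cmod (tcoeff g k))\<^sup>2)"
      by (intro summable_add summable_mult H2_summable assms)
    fix k
    have "(cmod (tcoeff f k + tcoeff g k))\<^sup>2 \<le> (cmod (tcoeff f k) + cmod (tcoeff g k))\<^sup>2"
      by (intro power_mono norm_triangle_ineq) auto
    also have "\<dots> \<le> 2 * (cmod (tcoeff f k))\<^sup>2 + 2 * (cmod (tcoeff g k))\<^sup>2"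
      using sum_squares_bound[of "cmod (tcoeff f k)" "cmod (tcoeff g k)"]
      by (simp add: power2_sum)
    finally show "norm ((cmod (tcoeff f k + tcoeff g k))\<^sup>2) \<le> \<dots>" by simp
  qed
  thus ?thesis
    using assms by (auto simp: H2_def tcoeff_add intro!: holomorphic_intros)
qed

lemma H2_cmult:
  assumes "f \<in> H2"
  shows "(\<lambda>z. c * f z) \<in> H2"
  using assms by (auto simp: H2_def tcoeff_cmult norm_mult power_mult_distrib
      intro!: holomorphic_intros summable_mult)

lemma H2_diff:
  assumes "f \<in> H2" "g \<in> H2"
  shows "(\<lambda>z. f z - g z) \<in> H2"
  using H2_add[OF assms(1) H2_cmult[OF assms(2), of "-1"]] by simp

lemma H2_zero: "(\<lambda>z. 0) \<in> H2"
proof -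
  have "tcoeff (\<lambda>z. 0) k = 0" for k by (rule tcoeff_powser) auto
  thus ?thesis by (auto simp: H2_def)
qed

lemma H2_sum:
  assumes "\<And>i. i \<in> I \<Longrightarrow> f i \<in> H2"
  shows "(\<lambda>z. \<Sum>i\<in>I. f i z) \<in> H2"
  using assms
  by (induction I rule: infinite_finite_induct) (auto intro: H2_zero H2_add)

lemma h2_norm_nonneg [simp]: "h2_norm f \<ge> 0" if "f \<in> H2"
  unfolding h2_norm_def by (intro real_sqrt_ge_zero suminf_nonneg H2_summable that) simp

lemma h2_norm_sq: "f \<in> H2 \<Longrightarrow> (h2_norm f)\<^sup>2 = (\<Sum>k. (cmod (tcoeff f k))\<^sup>2)"
  unfolding h2_norm_def by (intro real_sqrt_pow2 suminf_nonneg H2_summable) auto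

lemma h2_inner_add_left:
  assumes "f \<in> H2" "g \<in> H2" "h \<in> H2"
  shows "h2_inner (\<lambda>z. f z + g z) h = h2_inner f h + h2_inner g h"
  unfolding h2_inner_def
  by (simp add: tcoeff_add assms H2_holomorphic algebra_simps suminf_add summable_sq_cnj H2_summable)

lemma h2_inner_cmult_left:
  assumes "f \<in> H2" "h \<in> H2"
  shows "h2_inner (\<lambda>z. c * f z) h = c * h2_inner f h"
  unfolding h2_inner_def
  by (simp add: tcoeff_cmult assms H2_holomorphic mult.assoc suminf_mult summable_sq_cnj H2_summable)

lemma h2_inner_diff_left:
  assumes "f \<in> H2" "g \<in> H2" "h \<in> H2"
  shows "h2_inner (\<lambda>z. f z - g z) h = h2_inner f h - h2_inner g h"
  using h2_inner_add_left[OF assms(1) H2_cmult[OF assms(2), of "-1"] assms(3)]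
    h2_inner_cmult_left[OF assms(2,3), of "-1"] by simp

lemma h2_inner_zero_left [simp]: "h2_inner (\<lambda>z. 0) h = 0"
proof -
  have "tcoeff (\<lambda>z. 0) k = 0" for k by (rule tcoeff_powser) auto
  thus ?thesis by (simp add: h2_inner_def)
qed

lemma h2_inner_sum_left:
  assumes "\<And>i. i \<in> I \<Longrightarrow> f i \<in> H2" "h \<in> H2"
  shows "h2_inner (\<lambda>z. \<Sum>i\<in>I. f i z) h = (\<Sum>i\<in>I. h2_inner (f i) h)"
  using assms
  by (induction I rule: infinite_finite_induct) (auto simp: h2_inner_add_left H2_sum)

lemma h2_inner_commute:
  assumes "f \<in> H2" "g \<in> H2"
  shows "h2_inner g f = cnj (h2_inner f g)"
  unfolding h2_inner_def
  using sums_cnj[THEN iffD2, OF summable_sums[OF summable_sq_cnj[OF H2_summable[OF assms(1)] H2_summable[OF assms(2)]]]]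
  by (simp add: sums_iff mult.commute)

lemma h2_inner_self:
  assumes "f \<in> H2"
  shows "h2_inner f f = of_real ((h2_norm f)\<^sup>2)"
  unfolding h2_norm_sq[OF assms] h2_inner_def complex_norm_square[symmetric]
  using suminf_of_real[OF H2_summable[OF assms], where 'a = complex] by simp

lemma h2_Cauchy_Schwarz:
  assumes "f \<in> H2" "g \<in> H2"
  shows "cmod (h2_inner f g) \<le> h2_norm f * h2_norm g"
  unfolding h2_inner_def h2_norm_def
  by (intro Cauchy_Schwarz_suminf H2_summable assms)

lemma h2_norm_eq_0:
  assumes "f \<in> H2" "h2_norm f = 0"
  shows "f = (\<lambda>z. 0)"
proof (rule H2_eqI[OF assms(1) H2_zero])
  fix k
  have "tcoeff (\<lambda>z. 0) k = 0" by (rule tcoeff_powser) auto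
  moreover have "tcoeff f k = 0"
    using h2_norm_sq[OF assms(1)] suminf_eq_zero_iff[OF H2_summable[OF assms(1)]] assms(2) by simp
  ultimately show "tcoeff f k = tcoeff (\<lambda>z. 0) k" by simp
qed

lemma h2_inner_tendsto:
  assumes "\<And>k. f k \<in> H2" "g \<in> H2" "h \<in> H2"
    and "(\<lambda>k. h2_norm (\<lambda>z. f k z - g z)) \<longlonglongrightarrow> 0"
  shows "(\<lambda>k. h2_inner (f k) h) \<longlonglongrightarrow> h2_inner g h"
proof (rule LIM_zero_cancel, rule Lim_null_comparison)
  show "\<forall>\<^sub>F k in sequentially. norm (h2_inner (f k) h - h2_inner g h) \<le> h2_norm (\<lambda>z. f k z - g z) * h2_norm h"
    using h2_Cauchy_Schwarz[OF H2_diff[OF assms(1,2)] assms(3)]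
    by (simp add: h2_inner_diff_left assms)
  show "(\<lambda>k. h2_norm (\<lambda>z. f k z - g z) * h2_norm h) \<longlonglongrightarrow> 0"
    using tendsto_mult_left_zero[OF assms(4)] by simp
qed

section \<open>Functions built from square-summable coefficients; Taylor truncations and
  monomials\<close>

definition powser_disc :: "(nat \<Rightarrow> complex) \<Rightarrow> complex \<Rightarrow> complex" where
  "powser_disc a = (\<lambda>z. if z \<in> disc then (\<Sum>k. a k * z ^ k) else 0)"

lemma summable_powser_bounded:
  fixes a :: "nat \<Rightarrow> complex"
  assumes "\<And>k. cmod (a k) \<le> B" "cmod z < 1"
  shows "summable (\<lambda>k. cmod (a k * z ^ k))"
proof (rule summable_comparison_test')
  show "summable (\<lambda>k. B * cmod z ^ k)"
    using assms(2) by (intro summable_mult summable_geometric) auto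
  show "norm (cmod (a k * z ^ k)) \<le> B * cmod z ^ k" for k
    using assms(1)[of k] by (simp add: norm_mult norm_power mult_right_mono)
qed

lemma ell2_bounded:
  fixes a :: "nat \<Rightarrow> complex"
  assumes "summable (\<lambda>k. (cmod (a k))\<^sup>2)"
  shows "cmod (a k) \<le> sqrt (\<Sum>k. (cmod (a k))\<^sup>2)"
proof (rule real_le_rsqrt)
  show "(cmod (a k))\<^sup>2 \<le> (\<Sum>k. (cmod (a k))\<^sup>2)"
    using sum_le_suminf[OF assms, of "{k}"] by simp
qed

lemma powser_disc_sums:
  fixes a :: "nat \<Rightarrow> complex"
  assumes "summable (\<lambda>k. (cmod (a k))\<^sup>2)" "z \<in> disc"
  shows "(\<lambda>k. a k * z ^ k) sums powser_disc a z"
  using summable_norm_cancel[OF summable_powser_bounded[OF ell2_bounded[OF assms(1)], of z]] assms(2)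
  by (simp add: powser_disc_def mem_disc summable_sums)

lemma tcoeff_powser_disc:
  assumes "summable (\<lambda>k. (cmod (a k))\<^sup>2)"
  shows "tcoeff (powser_disc a) k = a k"
  by (rule tcoeff_powser, rule powser_disc_sums[OF assms])

lemma powser_disc_H2:
  assumes "summable (\<lambda>k. (cmod (a k))\<^sup>2)"
  shows "powser_disc a \<in> H2"
proof -
  have "powser_disc a holomorphic_on disc"
    unfolding disc_def
    by (rule power_series_holomorphic[where a = a]) (use powser_disc_sums[OF assms] in \<open>simp add: disc_def\<close>)
  thus ?thesis
    using assms by (simp add: H2_def tcoeff_powser_disc) (simp add: powser_disc_def)
qed

text \<open>Taylor polynomials, cut off to vanish outside the disc as membership in
  \<open>H2\<close> requires. They are bounded and norm dense, so they carry identities from bounded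
  functions to all of \<open>H2\<close>.\<close>

definition trunc :: "nat \<Rightarrow> (complex \<Rightarrow> complex) \<Rightarrow> complex \<Rightarrow> complex" where
  "trunc N f = powser_disc (\<lambda>k. if k < N then tcoeff f k else 0)"

lemma trunc_summable: "summable (\<lambda>k. (cmod (if k < N then a k else 0))\<^sup>2)"
  by (rule summable_finite[of "{..<N}"]) auto

lemma trunc_H2: "trunc N f \<in> H2"
  unfolding trunc_def by (rule powser_disc_H2[OF trunc_summable])

lemma tcoeff_trunc: "tcoeff (trunc N f) k = (if k < N then tcoeff f k else 0)"
  unfolding trunc_def by (subst tcoeff_powser_disc[OF trunc_summable]) simp

text \<open>The orthonormal basis of \<open>H2\<close>; in particular \<open>monom_disc 0\<close>
  plays the part of the constant function 1.\<close>

definition monom_disc :: "nat \<Rightarrow> complex \<Rightarrow> complex" where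
  "monom_disc k = (\<lambda>z. if z \<in> disc then z ^ k else 0)"

lemma tcoeff_monom_disc: "tcoeff (monom_disc k) m = (if m = k then 1 else 0)"
proof (rule tcoeff_powser)
  fix z assume "z \<in> disc"
  have "(\<lambda>m. if m = k then z ^ m else 0) sums z ^ k"
    using sums_single[of k "\<lambda>m. z ^ m"] by simp
  thus "(\<lambda>m. (if m = k then 1 else 0) * z ^ m) sums monom_disc k z"
    using \<open>z \<in> disc\<close> by (simp add: monom_disc_def if_distrib[of "\<lambda>c. c * _"] cong: if_cong)
qed

lemma monom_disc_H2: "monom_disc k \<in> H2"
proof -
  have "(\<lambda>z. z ^ k) holomorphic_on disc" by (intro holomorphic_intros)
  hence "monom_disc k holomorphic_on disc"
    by (rule holomorphic_transform) (simp add: monom_disc_def)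
  moreover have "summable (\<lambda>m. (cmod (tcoeff (monom_disc k) m))\<^sup>2)"
    by (rule summable_finite[of "{k}"]) (auto simp: tcoeff_monom_disc)
  ultimately show ?thesis by (auto simp: H2_def monom_disc_def)
qed

lemma h2_inner_monom_disc: "h2_inner f (monom_disc k) = tcoeff f k"
proof -
  have "(\<lambda>m. if m = k then tcoeff f m else 0) sums tcoeff f k"
    using sums_single[of k "tcoeff f"] by simp
  thus ?thesis
    by (simp add: h2_inner_def tcoeff_monom_disc sums_iff if_distrib[of "\<lambda>c. _ * c"] if_distrib[of cnj] cong: if_cong)
qed

lemma trunc_eq_sum: "trunc N f = (\<lambda>z. \<Sum>k<N. tcoeff f k * monom_disc k z)"
proof
  fix z
  have "(\<lambda>k. (if k < N then tcoeff f k else 0) * z ^ k) sums (\<Sum>k<N. tcoeff f k * z ^ k)"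
    using sums_If_finite_set[of "{..<N}" "\<lambda>k. tcoeff f k * z ^ k"]
    by (simp add: if_distrib[of "\<lambda>c. c * _"] cong: if_cong)
  thus "trunc N f z = (\<Sum>k<N. tcoeff f k * monom_disc k z)"
    by (auto simp: trunc_def powser_disc_def monom_disc_def sums_iff)
qed

lemma trunc_tendsto:
  assumes "f \<in> H2"
  shows "(\<lambda>N. h2_norm (\<lambda>z. trunc N f z - f z)) \<longlonglongrightarrow> 0"
proof -
  have coeff: "tcoeff (\<lambda>z. trunc N f z - f z) k = (if k < N then 0 else - tcoeff f k)" for N k
    using tcoeff_add[OF H2_holomorphic[OF trunc_H2] H2_holomorphic[OF H2_cmult[OF assms]], of N f "-1" k]
      tcoeff_cmult[OF H2_holomorphic[OF assms], of "-1" k]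
    by (simp add: tcoeff_trunc)
  have eq: "(\<Sum>k. (cmod (tcoeff (\<lambda>z. trunc N f z - f z) k))\<^sup>2) = (\<Sum>k. (cmod (tcoeff f (k + N)))\<^sup>2)" for N
  proof -
    have "summable (\<lambda>k. (cmod (tcoeff (\<lambda>z. trunc N f z - f z) k))\<^sup>2)"
      by (rule H2_summable[OF H2_diff[OF trunc_H2 assms]])
    from suminf_split_initial_segment[OF this, of N] show ?thesis
      by (simp add: coeff)
  qed
  have "(\<lambda>N. \<Sum>k. (cmod (tcoeff f (k + N)))\<^sup>2) \<longlonglongrightarrow> 0"
    by (rule suminf_exist_split2) (rule H2_summable[OF assms])
  hence "(\<lambda>N. sqrt (\<Sum>k. (cmod (tcoeff f (k + N)))\<^sup>2)) \<longlonglongrightarrow> sqrt 0"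
    by (rule tendsto_real_sqrt)
  thus ?thesis by (simp add: h2_norm_def eq)
qed

section \<open>Parseval's formula and multipliers\<close>

lemma integral_cis:
  "((\<lambda>t. cis (of_int m * t)) has_integral (if m = 0 then 2 * pi else 0)) {0..2*pi}"
proof (cases "m = 0")
  case True
  have "((\<lambda>t::real. 1::complex) has_integral (2*pi - 0) *\<^sub>R 1) {0..2*pi}"
    using has_integral_const_real[of "1::complex" 0 "2*pi"] by simp
  thus ?thesis using True by (simp add: scaleR_conv_of_real)
next
  case False
  have "((\<lambda>t. exp (\<i> * of_int m * of_real t)) has_integral
      (exp (\<i> * of_int m * of_real (2*pi)) / (\<i> * of_int m) - exp (\<i> * of_int m * of_real 0) / (\<i> * of_int m))) {0..2*pi}"
    by (rule fundamental_theorem_of_calculus)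
       (use False in \<open>auto intro!: derivative_eq_intros has_vector_derivative_real_field\<close>)
  moreover have "exp (\<i> * of_int m * of_real (2*pi)) = 1"
    using exp_integer_2pi[of "of_int m"] by (simp add: mult_ac)
  ultimately show ?thesis using False by (simp add: cis_conv_exp mult_ac)
qed

lemma abs_summable_tcoeff:
  assumes "f holomorphic_on disc" "0 \<le> r" "r < 1"
  shows "summable (\<lambda>k. cmod (tcoeff f k) * r ^ k)"
proof -
  define s where "s = (1 + r) / 2"
  have s: "r < s" "s < 1" using assms by (auto simp: s_def)
  have "summable (\<lambda>k. tcoeff f k * (of_real s) ^ k)"
    using sums_tcoeff[OF assms(1), of "of_real s"] s assms by (auto simp: mem_disc sums_iff)
  hence "summable (\<lambda>k. norm (tcoeff f k * (of_real r) ^ k))"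
    by (rule powser_insidea) (use s assms in auto)
  thus ?thesis using assms by (simp add: norm_mult norm_power)
qed

lemma circle_in_disc: "0 \<le> r \<Longrightarrow> r < 1 \<Longrightarrow> of_real r * cis t \<in> disc"
  by (simp add: mem_disc norm_mult)

lemma continuous_on_circle:
  assumes "f holomorphic_on disc" "0 \<le> r" "r < 1"
  shows "continuous_on A (\<lambda>t. f (of_real r * cis t))"
proof -
  have "continuous_on A (f \<circ> (\<lambda>t. of_real r * cis t))"
  proof (rule continuous_on_compose)
    show "continuous_on A (\<lambda>t. of_real r * cis t)"
      by (intro continuous_intros)
    show "continuous_on ((\<lambda>t. of_real r * cis t) ` A) f"
      by (rule continuous_on_subset[OF holomorphic_on_imp_continuous_on[OF assms(1)]])
         (use circle_in_disc[OF assms(2,3)] in auto)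
  qed
  thus ?thesis by (simp add: o_def)
qed

text \<open>Absolute summability at radius r < 1 makes the series uniformly convergent on the
  circle, so it can be integrated term by term. The weight \<phi> is left general for two uses: a
  character, which isolates one coefficient, and the conjugate of a second function, which gives
  Parseval's formula.\<close>

lemma circle_expansion:
  assumes "f holomorphic_on disc" "0 \<le> r" "r < 1" "continuous_on {0..2*pi} \<phi>"
  shows "(\<lambda>k. tcoeff f k * of_real r ^ k * integral {0..2*pi} (\<lambda>t. cis (real k * t) * \<phi> t))
           sums integral {0..2*pi} (\<lambda>t. f (of_real r * cis t) * \<phi> t)"
proof -
  define g where "g = (\<lambda>k t. tcoeff f k * of_real r ^ k * (cis (real k * t) * \<phi> t))"
  have cont: "continuous_on {0..2*pi} (g k)" for k
    unfolding g_def by (intro continuous_intros assms(4))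
  have "compact (\<phi> ` {0..2*pi})"
    using assms(4) by (intro compact_continuous_image) auto
  then obtain B where B: "\<And>t. t \<in> {0..2*pi} \<Longrightarrow> cmod (\<phi> t) \<le> B"
    using compact_imp_bounded bounded_iff by (metis imageI)
  have "uniform_limit {0..2*pi} (\<lambda>n t. \<Sum>k<n. g k t) (\<lambda>t. \<Sum>k. g k t) sequentially"
  proof (rule Weierstrass_m_test)
    show "norm (g k t) \<le> cmod (tcoeff f k) * r ^ k * B" if "t \<in> {0..2*pi}" for k t
      using B[OF that] assms(2) by (auto simp: g_def norm_mult norm_power intro!: mult_left_mono)
    show "summable (\<lambda>k. cmod (tcoeff f k) * r ^ k * B)"
      by (intro summable_mult2 abs_summable_tcoeff assms)
  qed
  moreover have "(\<Sum>k. g k t) = f (of_real r * cis t) * \<phi> t" for t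
  proof -
    have "(\<lambda>k. tcoeff f k * (of_real r * cis t) ^ k * \<phi> t) sums (f (of_real r * cis t) * \<phi> t)"
      by (intro sums_mult2 sums_tcoeff assms circle_in_disc)
    moreover have "(\<lambda>k. tcoeff f k * (of_real r * cis t) ^ k * \<phi> t) = (\<lambda>k. g k t)"
      by (simp add: g_def power_mult_distrib Complex.DeMoivre mult.assoc)
    ultimately show ?thesis by (simp add: sums_iff)
  qed
  ultimately have "uniform_limit {0..2*pi} (\<lambda>n t. \<Sum>k<n. g k t) (\<lambda>t. f (of_real r * cis t) * \<phi> t) sequentially"
    by simp
  then obtain I J where IJ: "\<And>n. ((\<lambda>t. \<Sum>k<n. g k t) has_integral I n) {0..2*pi}"
      "((\<lambda>t. f (of_real r * cis t) * \<phi> t) has_integral J) {0..2*pi}" "I \<longlonglongrightarrow> J"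
    by (rule uniform_limit_integral) (auto intro!: continuous_intros cont)
  have "I = (\<lambda>n. \<Sum>k<n. integral {0..2*pi} (g k))"
  proof
    fix n show "I n = (\<Sum>k<n. integral {0..2*pi} (g k))"
      using IJ(1)[of n] integral_sum[of "{..<n}" g "{0..2*pi}"] integrable_continuous_real[OF cont]
      by (simp add: integral_unique)
  qed
  with IJ(3) have "(\<lambda>k. integral {0..2*pi} (g k)) sums J"
    unfolding sums_def by simp
  hence "(\<lambda>k. integral {0..2*pi} (g k)) sums integral {0..2*pi} (\<lambda>t. f (of_real r * cis t) * \<phi> t)"
    by (simp only: integral_unique[OF IJ(2)])
  thus ?thesis by (simp add: g_def)
qed

text \<open>Stands in for the inner product over the boundary circle, so that f and g need no
  boundary values; the inner product is recovered as r tends to 1.\<close>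

definition circle_mean :: "real \<Rightarrow> (complex \<Rightarrow> complex) \<Rightarrow> (complex \<Rightarrow> complex) \<Rightarrow> complex" where
  "circle_mean r f g =
     integral {0..2*pi} (\<lambda>t. f (of_real r * cis t) * cnj (g (of_real r * cis t))) / of_real (2*pi)"

lemma circle_coefficient:
  assumes "g holomorphic_on disc" "0 \<le> r" "r < 1"
  shows "integral {0..2*pi} (\<lambda>t. cis (real k * t) * cnj (g (of_real r * cis t)))
           = of_real (2*pi) * cnj (tcoeff g k) * of_real r ^ k"
proof -
  have "(\<lambda>j. tcoeff g j * of_real r ^ j * integral {0..2*pi} (\<lambda>t. cis (real j * t) * cis (- real k * t)))
      sums integral {0..2*pi} (\<lambda>t. g (of_real r * cis t) * cis (- real k * t))"
    by (intro circle_expansion assms continuous_intros)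
  moreover have "integral {0..2*pi} (\<lambda>t. cis (real j * t) * cis (- real k * t)) =
      (if j = k then of_real (2*pi) else 0)" for j
    using integral_unique[OF integral_cis[of "int j - int k"]]
    by (simp add: cis_mult algebra_simps)
  ultimately have "(\<lambda>j. if j = k then tcoeff g j * of_real r ^ j * of_real (2*pi) else 0)
      sums integral {0..2*pi} (\<lambda>t. g (of_real r * cis t) * cis (- real k * t))"
    by (simp add: if_distrib[of "\<lambda>c. _ * c"] cong: if_cong)
  moreover have "(\<lambda>j. if j = k then tcoeff g j * of_real r ^ j * of_real (2*pi) else 0)
      sums (tcoeff g k * of_real r ^ k * of_real (2*pi))"
    by (rule sums_single)
  ultimately have "integral {0..2*pi} (\<lambda>t. g (of_real r * cis t) * cis (- real k * t))
      = tcoeff g k * of_real r ^ k * of_real (2*pi)"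
    by (rule sums_unique2)
  hence "cnj (integral {0..2*pi} (\<lambda>t. g (of_real r * cis t) * cis (- real k * t)))
      = of_real (2*pi) * cnj (tcoeff g k) * of_real r ^ k"
    by simp
  thus ?thesis
    by (simp add: integral_cnj cis_cnj mult.commute)
qed

lemma Parseval_circle:
  assumes "f holomorphic_on disc" "g holomorphic_on disc" "0 \<le> r" "r < 1"
  shows "(\<lambda>k. tcoeff f k * cnj (tcoeff g k) * of_real (r ^ (2 * k))) sums circle_mean r f g"
proof -
  have "(\<lambda>k. tcoeff f k * of_real r ^ k * integral {0..2*pi} (\<lambda>t. cis (real k * t) * cnj (g (of_real r * cis t))))
     sums integral {0..2*pi} (\<lambda>t. f (of_real r * cis t) * cnj (g (of_real r * cis t)))"
    by (intro circle_expansion assms continuous_intros continuous_on_circle)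
  from sums_divide[OF this, of "of_real (2*pi)"]
  have "(\<lambda>k. tcoeff f k * of_real r ^ k * (of_real (2*pi) * cnj (tcoeff g k) * of_real r ^ k) / of_real (2*pi))
      sums circle_mean r f g"
    unfolding circle_coefficient[OF assms(2-4)] circle_mean_def .
  moreover have "tcoeff f k * of_real r ^ k * (of_real (2*pi) * cnj (tcoeff g k) * of_real r ^ k) / of_real (2*pi)
      = tcoeff f k * cnj (tcoeff g k) * of_real (r ^ (2 * k))" for k
    by (simp add: mult_2[of k] power_add)
  ultimately show ?thesis by (simp only:)
qed

lemma circle_mean_self:
  assumes "f holomorphic_on disc" "0 \<le> r" "r < 1"
  shows "(\<lambda>k. (cmod (tcoeff f k))\<^sup>2 * r ^ (2 * k)) sums
           (integral {0..2*pi} (\<lambda>t. (cmod (f (of_real r * cis t)))\<^sup>2) / (2*pi))"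
proof -
  have "circle_mean r f f = of_real (integral {0..2*pi} (\<lambda>t. (cmod (f (of_real r * cis t)))\<^sup>2) / (2*pi))"
  proof -
    have "((\<lambda>t. (cmod (f (of_real r * cis t)))\<^sup>2) has_integral
        integral {0..2*pi} (\<lambda>t. (cmod (f (of_real r * cis t)))\<^sup>2)) {0..2*pi}"
      by (intro integrable_integral integrable_continuous_real continuous_intros continuous_on_circle assms)
    from has_integral_of_real[OF this, where 'b = complex] show ?thesis
      by (simp add: circle_mean_def complex_norm_square[symmetric] integral_unique del: of_real_power)
  qed
  with Parseval_circle[OF assms(1,1,2,3)] show ?thesis
    unfolding complex_norm_square[symmetric] of_real_mult[symmetric] of_real_power[symmetric]
    by (simp only: sums_of_real_iff)
qed

section \<open>Bounded holomorphic multipliers on \<open>H2\<close>\<close>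

lemma Hinf_mult_holomorphic:
  assumes "u \<in> Hinf" "f \<in> H2"
  shows "(\<lambda>z. u z * f z) holomorphic_on disc"
  using assms by (auto simp: Hinf_def H2_def intro!: holomorphic_intros)

text \<open>Parseval at radius r < 1 compares the two means pointwise under the integral. The claim
  is about partial sums because summability for the product is not yet known, and because r can then
  tend to 1 in a finite sum.\<close>

lemma Hinf_mult_partial_sums:
  assumes "u \<in> Hinf" "f \<in> H2" "\<And>z. z \<in> disc \<Longrightarrow> cmod (u z) \<le> C"
  shows "(\<Sum>k<N. (cmod (tcoeff (\<lambda>z. u z * f z) k))\<^sup>2) \<le> C\<^sup>2 * (h2_norm f)\<^sup>2"
proof -
  let ?h = "\<lambda>z. u z * f z"
  note hol = Hinf_mult_holomorphic[OF assms(1,2)]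
  have bound: "(\<Sum>k<N. (cmod (tcoeff ?h k))\<^sup>2 * r ^ (2 * k)) \<le> C\<^sup>2 * (h2_norm f)\<^sup>2" if r: "0 \<le> r" "r < 1" for r
  proof -
    let ?I = "\<lambda>f. integral {0..2*pi} (\<lambda>t. (cmod (f (of_real r * cis t)))\<^sup>2)"
    note sh = circle_mean_self[OF hol r] and sf = circle_mean_self[OF H2_holomorphic[OF assms(2)] r]
    have "(\<Sum>k<N. (cmod (tcoeff ?h k))\<^sup>2 * r ^ (2 * k)) \<le> ?I ?h / (2*pi)"
      using sum_le_suminf[OF sums_summable[OF sh], of "{..<N}"] sums_unique[OF sh] r by auto
    also have "?I ?h \<le> integral {0..2*pi} (\<lambda>t. C\<^sup>2 * (cmod (f (of_real r * cis t)))\<^sup>2)"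
    proof (rule integral_le)
      show "(\<lambda>t. (cmod (?h (of_real r * cis t)))\<^sup>2) integrable_on {0..2*pi}"
        by (intro integrable_continuous_real continuous_intros continuous_on_circle[OF hol r])
      show "(\<lambda>t. C\<^sup>2 * (cmod (f (of_real r * cis t)))\<^sup>2) integrable_on {0..2*pi}"
        by (intro integrable_continuous_real continuous_intros continuous_on_circle[OF H2_holomorphic[OF assms(2)] r])
      show "(cmod (?h (of_real r * cis t)))\<^sup>2 \<le> C\<^sup>2 * (cmod (f (of_real r * cis t)))\<^sup>2" for t
        using assms(3)[OF circle_in_disc[OF r]] unfolding norm_mult power_mult_distrib
        by (intro mult_right_mono power_mono) auto
    qed
    also have "\<dots> = C\<^sup>2 * ?I f" by simp
    also have "C\<^sup>2 * ?I f / (2*pi) = C\<^sup>2 * (\<Sum>k. (cmod (tcoeff f k))\<^sup>2 * r ^ (2 * k))"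
      by (simp flip: sums_unique[OF sf])
    also have "(\<Sum>k. (cmod (tcoeff f k))\<^sup>2 * r ^ (2 * k)) \<le> (\<Sum>k. (cmod (tcoeff f k))\<^sup>2)"
      by (intro suminf_le sums_summable[OF sf] H2_summable assms)
         (use r in \<open>auto intro!: mult_left_le power_le_one\<close>)
    finally show ?thesis using h2_norm_sq[OF assms(2)] by (simp add: divide_right_mono mult_left_mono)
  qed
  have "((\<lambda>r. \<Sum>k<N. (cmod (tcoeff ?h k))\<^sup>2 * r ^ (2 * k)) \<longlongrightarrow> (\<Sum>k<N. (cmod (tcoeff ?h k))\<^sup>2 * 1 ^ (2 * k))) (at_left 1)"
    by (intro tendsto_intros)
  moreover have "\<forall>\<^sub>F r::real in at_left 1. (\<Sum>k<N. (cmod (tcoeff ?h k))\<^sup>2 * r ^ (2 * k)) \<le> C\<^sup>2 * (h2_norm f)\<^sup>2"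
    using eventually_at_left_real[of 0 1] by (auto elim!: eventually_mono intro!: bound)
  ultimately show ?thesis
    by (auto dest: tendsto_upperbound)
qed

lemma Hinf_mult_H2:
  assumes "u \<in> Hinf" "f \<in> H2"
  shows "(\<lambda>z. u z * f z) \<in> H2"
proof -
  obtain C where "\<And>z. z \<in> disc \<Longrightarrow> cmod (u z) \<le> C"
    using assms(1) by (auto simp: Hinf_def bounded_iff)
  from Hinf_mult_partial_sums[OF assms this]
  have "summable (\<lambda>k. (cmod (tcoeff (\<lambda>z. u z * f z) k))\<^sup>2)"
    by (intro summableI_nonneg_bounded) auto
  thus ?thesis
    using Hinf_mult_holomorphic[OF assms] H2_outside[OF assms(2)] by (simp add: H2_def)
qed

lemma h2_norm_Hinf_mult:
  assumes "u \<in> Hinf" "f \<in> H2" "C \<ge> 0" "\<And>z. z \<in> disc \<Longrightarrow> cmod (u z) \<le> C"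
  shows "h2_norm (\<lambda>z. u z * f z) \<le> C * h2_norm f"
proof (rule power2_le_imp_le)
  show "(h2_norm (\<lambda>z. u z * f z))\<^sup>2 \<le> (C * h2_norm f)\<^sup>2"
    unfolding h2_norm_sq[OF Hinf_mult_H2[OF assms(1,2)]] power_mult_distrib
    by (intro suminf_le_const H2_summable Hinf_mult_H2 assms Hinf_mult_partial_sums)
qed (use assms in auto)

lemma Hinf_mult_tendsto:
  assumes "u \<in> Hinf" "\<And>k. f k \<in> H2" "g \<in> H2" "(\<lambda>k. h2_norm (\<lambda>z. f k z - g z)) \<longlonglongrightarrow> 0"
  shows "(\<lambda>k. h2_norm (\<lambda>z. u z * f k z - u z * g z)) \<longlonglongrightarrow> 0"
proof -
  obtain C where C: "\<And>z. z \<in> disc \<Longrightarrow> cmod (u z) \<le> C"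
    using assms(1) by (auto simp: Hinf_def bounded_iff)
  have "C \<ge> 0" using C[OF zero_in_disc] norm_ge_zero order_trans by blast
  have le: "h2_norm (\<lambda>z. u z * f k z - u z * g z) \<le> C * h2_norm (\<lambda>z. f k z - g z)" for k
    using h2_norm_Hinf_mult[OF assms(1) H2_diff[OF assms(2,3)] \<open>C \<ge> 0\<close> C]
    by (simp add: right_diff_distrib)
  show ?thesis
  proof (rule Lim_null_comparison)
    show "\<forall>\<^sub>F k in sequentially. norm (h2_norm (\<lambda>z. u z * f k z - u z * g z)) \<le> C * h2_norm (\<lambda>z. f k z - g z)"
      using le h2_norm_nonneg[OF H2_diff[OF Hinf_mult_H2 Hinf_mult_H2]] assms(1-3) by simp
    show "(\<lambda>k. C * h2_norm (\<lambda>z. f k z - g z)) \<longlonglongrightarrow> 0"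
      using tendsto_mult_right_zero[OF assms(4)] .
  qed
qed

text \<open>Tannery's theorem, with the products of the moduli of the coefficients as majorant. The
  radii form a sequence to suit dominated convergence later on; the shift by 2 keeps them in [1/2,
  1).\<close>

lemma circle_mean_tendsto:
  assumes "f \<in> H2" "g \<in> H2"
  shows "(\<lambda>l. circle_mean (1 - 1 / (real l + 2)) f g) \<longlonglongrightarrow> h2_inner f g"
proof -
  let ?r = "\<lambda>l::nat. 1 - 1 / (real l + 2)"
  have r: "0 \<le> ?r l" "?r l < 1" for l by (auto simp: field_simps)
  have rlim: "?r \<longlonglongrightarrow> 1" by real_asymp
  let ?a = "\<lambda>k l. tcoeff f k * cnj (tcoeff g k) * of_real (?r l ^ (2 * k))"
  have "(\<lambda>l. suminf (\<lambda>k. ?a k l)) \<longlonglongrightarrow> suminf (\<lambda>k. tcoeff f k * cnj (tcoeff g k))"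
  proof (rule tannerys_theorem[THEN conjunct2, THEN conjunct2])
    show "(\<lambda>l. ?a k l) \<longlonglongrightarrow> tcoeff f k * cnj (tcoeff g k)" for k
    proof -
      have "(\<lambda>l. ?a k l) \<longlonglongrightarrow> tcoeff f k * cnj (tcoeff g k) * of_real (1 ^ (2 * k))"
        by (intro tendsto_intros rlim)
      thus ?thesis by simp
    qed
    have "norm (?a k l) \<le> cmod (tcoeff f k) * cmod (tcoeff g k)" for k l
    proof -
      have "\<bar>?r l ^ (2 * k)\<bar> \<le> 1" using r[of l] by (simp add: power_le_one)
      thus ?thesis unfolding norm_mult norm_of_real complex_mod_cnj by (intro mult_left_le) auto
    qed
    thus "\<forall>\<^sub>F (k, l) in sequentially \<times>\<^sub>F sequentially. norm (?a k l) \<le> cmod (tcoeff f k) * cmod (tcoeff g k)"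
      by (intro always_eventually) auto
    show "summable (\<lambda>k. cmod (tcoeff f k) * cmod (tcoeff g k))"
      by (intro summable_sq_mult H2_summable assms)
  qed auto
  moreover have "suminf (\<lambda>k. ?a k l) = circle_mean (?r l) f g" for l
    using Parseval_circle[OF assms[THEN H2_holomorphic] r] by (simp add: sums_iff)
  ultimately show ?thesis by (simp add: h2_inner_def)
qed

section \<open>Model spaces\<close>

text \<open>The means for the pairs \<theta> f, \<theta> g and f, g differ by the integral of
  (|\<theta>|^2 - 1) f cnj(g). The first factor tends to 0 almost everywhere along radii.
  Boundedness of f and g supplies the dominating function and makes their own radial limits
  unnecessary.\<close>

lemma inner_fn_isometry_bounded:
  assumes "inner_fn \<theta>" "f \<in> H2" "g \<in> H2"
    and B: "\<And>z. z \<in> disc \<Longrightarrow> cmod (f z) \<le> B" "\<And>z. z \<in> disc \<Longrightarrow> cmod (g z) \<le> B"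
  shows "h2_inner (\<lambda>z. \<theta> z * f z) (\<lambda>z. \<theta> z * g z) = h2_inner f g"
proof -
  let ?r = "\<lambda>l::nat. 1 - 1 / (real l + 2)"
  let ?\<theta>f = "\<lambda>z. \<theta> z * f z" and ?\<theta>g = "\<lambda>z. \<theta> z * g z"
  have r: "0 \<le> ?r l" "?r l < 1" for l by (auto simp: field_simps)
  have rlim: "filterlim ?r (at_left 1) sequentially" by real_asymp
  have u: "\<theta> \<in> Hinf" using assms(1) by (simp add: inner_fn_def)
  then obtain C where C: "\<And>z. z \<in> disc \<Longrightarrow> cmod (\<theta> z) \<le> C"
    by (auto simp: Hinf_def bounded_iff)
  have hol: "\<theta> holomorphic_on disc" using u by (simp add: Hinf_def)
  note H = Hinf_mult_H2[OF u assms(2)] Hinf_mult_H2[OF u assms(3)]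
  note cont = continuous_on_circle[OF hol r] continuous_on_circle[OF H2_holomorphic[OF assms(2)] r]
    continuous_on_circle[OF H2_holomorphic[OF assms(3)] r]
  define D where "D = (\<lambda>l t. (of_real ((cmod (\<theta> (of_real (?r l) * cis t)))\<^sup>2) - 1) *
      (f (of_real (?r l) * cis t) * cnj (g (of_real (?r l) * cis t))))"
  have contD: "continuous_on A (D l)" for A l
    unfolding D_def by (intro continuous_intros cont)
  have lim0: "(\<lambda>l. \<integral>t. indicator {0..2*pi} t *\<^sub>R D l t \<partial>lborel) \<longlonglongrightarrow> integral\<^sup>L lborel (\<lambda>t::real. 0 :: complex)"
  proof (rule integral_dominated_convergence[where w = "\<lambda>t. indicator {0..2*pi} t *\<^sub>R ((C\<^sup>2 + 1) * (B * B))"])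
    show "(\<lambda>t. indicator {0..2*pi} t *\<^sub>R D l t) \<in> borel_measurable lborel" for l
      using borel_measurable_continuous_on_indicator[OF _ contD, of "{0..2*pi}" l] by simp
    show "integrable lborel (\<lambda>t::real. indicator {0..2*pi} t *\<^sub>R ((C\<^sup>2 + 1) * (B * B)))"
      by (simp add: integrable_mult_left)
    have "norm (D l t) \<le> (C\<^sup>2 + 1) * (B * B)" for l t
    proof -
      let ?z = "of_real (?r l) * cis t"
      have z: "?z \<in> disc" by (rule circle_in_disc[OF r])
      have "norm (of_real ((cmod (\<theta> ?z))\<^sup>2) - 1 :: complex) \<le> (cmod (\<theta> ?z))\<^sup>2 + 1"
        using norm_triangle_ineq4[of "of_real ((cmod (\<theta> ?z))\<^sup>2)" "1::complex"]
        by (simp add: norm_power)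
      also have "\<dots> \<le> C\<^sup>2 + 1" using C[OF z] by (simp add: power_mono)
      finally have 1: "norm (of_real ((cmod (\<theta> ?z))\<^sup>2) - 1 :: complex) \<le> C\<^sup>2 + 1" .
      have 2: "cmod (f ?z * cnj (g ?z)) \<le> B * B"
        unfolding norm_mult complex_mod_cnj by (intro mult_mono' B z norm_ge_zero)
      show ?thesis unfolding D_def norm_mult[of "_ - _"]
        by (intro mult_mono' 1 2 norm_ge_zero)
    qed
    thus "AE t in lborel. norm (indicator {0..2*pi} t *\<^sub>R D l t) \<le> indicator {0..2*pi} t *\<^sub>R ((C\<^sup>2 + 1) * (B * B))" for l
      by (intro AE_I2) (auto simp: indicator_def)
    have "AE t in lborel. t \<in> {0..2*pi} \<longrightarrow>
        (\<exists>c. cmod c = 1 \<and> ((\<lambda>r::real. \<theta> (complex_of_real r * cis t)) \<longlongrightarrow> c) (at_left 1))"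
      using assms(1) by (simp add: inner_fn_def)
    thus "AE t in lborel. (\<lambda>l. indicator {0..2*pi} t *\<^sub>R D l t) \<longlonglongrightarrow> 0"
    proof eventually_elim
      case (elim t)
      show ?case
      proof (cases "t \<in> {0..2*pi}")
        case True
        with elim obtain c where c: "cmod c = 1" "((\<lambda>r. \<theta> (complex_of_real r * cis t)) \<longlongrightarrow> c) (at_left 1)"
          by blast
        have "(\<lambda>l. \<theta> (of_real (?r l) * cis t)) \<longlonglongrightarrow> c"
          by (rule filterlim_compose[OF c(2) rlim])
        hence "(\<lambda>l. of_real ((cmod (\<theta> (of_real (?r l) * cis t)))\<^sup>2) - 1) \<longlonglongrightarrow> (of_real ((cmod c)\<^sup>2) - 1 :: complex)"
          by (intro tendsto_intros)
        hence "(\<lambda>l. of_real ((cmod (\<theta> (of_real (?r l) * cis t)))\<^sup>2) - 1) \<longlonglongrightarrow> (0::complex)"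
          using c(1) by simp
        moreover have "cmod (f (of_real (?r l) * cis t) * cnj (g (of_real (?r l) * cis t))) \<le> B * B" for l
          unfolding norm_mult complex_mod_cnj by (intro mult_mono' B circle_in_disc[OF r] norm_ge_zero)
        ultimately have "(\<lambda>l. D l t) \<longlonglongrightarrow> 0"
          unfolding D_def by (intro lim_null_mult_right_bounded[where B = "B * B"] always_eventually) auto
        thus ?thesis using True by simp
      qed simp
    qed
  qed auto
  have D1: "(\<integral>t. indicator {0..2*pi} t *\<^sub>R D l t \<partial>lborel) = integral {0..2*pi} (D l)" for l
    using set_borel_integral_eq_integral(2)[OF borel_integrable_atLeastAtMost'[OF contD]]
    by (simp add: set_lebesgue_integral_def)
  have D2: "integral {0..2*pi} (D l) / of_real (2*pi) = circle_mean (?r l) ?\<theta>f ?\<theta>g - circle_mean (?r l) f g" for l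
  proof -
    have "D l = (\<lambda>t. ?\<theta>f (of_real (?r l) * cis t) * cnj (?\<theta>g (of_real (?r l) * cis t))
        - f (of_real (?r l) * cis t) * cnj (g (of_real (?r l) * cis t)))"
      unfolding D_def complex_norm_square by (simp add: algebra_simps)
    hence "integral {0..2*pi} (D l) =
        integral {0..2*pi} (\<lambda>t. ?\<theta>f (of_real (?r l) * cis t) * cnj (?\<theta>g (of_real (?r l) * cis t)))
        - integral {0..2*pi} (\<lambda>t. f (of_real (?r l) * cis t) * cnj (g (of_real (?r l) * cis t)))"
      by (simp only:) (intro integral_diff integrable_continuous_real continuous_intros cont)
    thus ?thesis by (simp only: circle_mean_def diff_divide_distrib)
  qed
  have "(\<lambda>l. integral {0..2*pi} (D l) / of_real (2*pi)) \<longlonglongrightarrow> 0"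
    using lim0 unfolding D1 by (intro tendsto_divide_zero) simp
  hence "(\<lambda>l. circle_mean (?r l) ?\<theta>f ?\<theta>g - circle_mean (?r l) f g) \<longlonglongrightarrow> 0"
    unfolding D2 .
  moreover have "(\<lambda>l. circle_mean (?r l) ?\<theta>f ?\<theta>g - circle_mean (?r l) f g) \<longlonglongrightarrow> h2_inner ?\<theta>f ?\<theta>g - h2_inner f g"
    by (intro tendsto_diff circle_mean_tendsto H assms)
  ultimately have "h2_inner ?\<theta>f ?\<theta>g - h2_inner f g = 0"
    by (rule LIMSEQ_unique[rotated])
  thus ?thesis by simp
qed

lemma trunc_bounded: "\<exists>B. \<forall>z\<in>disc. cmod (trunc N f z) \<le> B"
proof -
  have "cmod (trunc N f z) \<le> (\<Sum>k<N. cmod (tcoeff f k))" for z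
    unfolding trunc_eq_sum
  proof (rule sum_norm_le)
    fix k
    have "cmod (monom_disc k z) \<le> 1"
      by (simp add: monom_disc_def mem_disc norm_power power_le_one)
    thus "cmod (tcoeff f k * monom_disc k z) \<le> cmod (tcoeff f k)"
      by (simp add: norm_mult mult_left_le)
  qed
  thus ?thesis by blast
qed

text \<open>Bounded truncations are replaced by general elements one argument at a time, using that
  multiplication by \<theta> is continuous on \<open>H2\<close>.\<close>

lemma inner_fn_isometry:
  assumes "inner_fn \<theta>" "f \<in> H2" "g \<in> H2"
  shows "h2_inner (\<lambda>z. \<theta> z * f z) (\<lambda>z. \<theta> z * g z) = h2_inner f g"
proof -
  have u: "\<theta> \<in> Hinf" using assms(1) by (simp add: inner_fn_def)
  let ?m = "\<lambda>f z. \<theta> z * f z"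
  have H: "?m f \<in> H2" if "f \<in> H2" for f using Hinf_mult_H2[OF u that] .
  have lim: "(\<lambda>N. h2_inner (?m (trunc N f)) (?m g)) \<longlonglongrightarrow> h2_inner (?m f) (?m g)"
    if "f \<in> H2" "g \<in> H2" for f g
    by (intro h2_inner_tendsto H trunc_H2 that Hinf_mult_tendsto u trunc_tendsto)
  have lim': "(\<lambda>N. h2_inner (trunc N f) g) \<longlonglongrightarrow> h2_inner f g" if "f \<in> H2" "g \<in> H2" for f g
    by (intro h2_inner_tendsto trunc_H2 that trunc_tendsto)
  have 1: "h2_inner (?m (trunc N f)) (?m (trunc M g)) = h2_inner (trunc N f) (trunc M g)" for N M f g
  proof -
    obtain A B where "\<forall>z\<in>disc. cmod (trunc N f z) \<le> A" "\<forall>z\<in>disc. cmod (trunc M g z) \<le> B"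
      using trunc_bounded by metis
    thus ?thesis
      by (intro inner_fn_isometry_bounded[OF assms(1) trunc_H2 trunc_H2, where B = "max A B"]) force+
  qed
  have 2: "h2_inner (?m f) (?m (trunc M g)) = h2_inner f (trunc M g)" if "f \<in> H2" for f M g
    using lim[OF that trunc_H2[of M g]] unfolding 1
    by (rule LIMSEQ_unique[OF _ lim'[OF that trunc_H2]])
  \<comment> \<open>Conjugate symmetry swaps the arguments, because \<open>h2_inner_tendsto\<close>
    takes limits in the first one.\<close>
  have 3: "h2_inner (?m (trunc M g)) (?m f) = h2_inner (trunc M g) f" if "f \<in> H2" for f M g
    using 2[OF that, of M g] h2_inner_commute[OF that trunc_H2] h2_inner_commute[OF H[OF that] H[OF trunc_H2]]
    by simp
  show ?thesis
    using lim[OF assms(2,3)] unfolding 3[OF assms(3)]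
    by (rule LIMSEQ_unique[OF _ lim'[OF assms(2,3)]])
qed

section \<open>Orthogonal projection onto the model space, and congruence modulo \<theta>
  \<open>H2\<close>\<close>

lemma model_space_H2: "f \<in> model_space \<theta> \<Longrightarrow> f \<in> H2"
  by (simp add: model_space_def)

lemma model_space_orth:
  assumes "\<theta> \<in> Hinf" "f \<in> model_space \<theta>" "g \<in> H2"
  shows "h2_inner (\<lambda>z. \<theta> z * g z) f = 0"
  using assms h2_inner_commute[OF model_space_H2 Hinf_mult_H2, of f \<theta> \<theta> g] by (simp add: model_space_def)

lemma model_space_diff:
  assumes "\<theta> \<in> Hinf" "f \<in> model_space \<theta>" "g \<in> model_space \<theta>"
  shows "(\<lambda>z. f z - g z) \<in> model_space \<theta>"
  using assms by (auto simp: model_space_def h2_inner_diff_left Hinf_mult_H2 intro: H2_diff)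

text \<open>The witness g is the adjoint of multiplication by \<theta> applied to f: its k-th
  coefficient is the inner product of f with \<theta> z^k. By the isometry these functions are
  orthonormal, so Bessel's inequality puts g into \<open>H2\<close>, and f - \<theta> g is
  orthogonal to each of them, hence by truncation to all of \<theta> \<open>H2\<close>.\<close>

lemma model_space_decomposition:
  assumes "inner_fn \<theta>" "f \<in> H2"
  shows "\<exists>g\<in>H2. (\<lambda>z. f z - \<theta> z * g z) \<in> model_space \<theta>"
proof -
  have u: "\<theta> \<in> Hinf" using assms(1) by (simp add: inner_fn_def)
  let ?m = "\<lambda>f z. \<theta> z * f z"
  have H: "?m f \<in> H2" if "f \<in> H2" for f using Hinf_mult_H2[OF u that] .
  have sum_m: "h2_inner (?m (\<lambda>z. \<Sum>k<N. a k * monom_disc k z)) p = (\<Sum>k<N. a k * h2_inner (?m (monom_disc k)) p)"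
    if "p \<in> H2" for p N and a :: "nat \<Rightarrow> complex"
  proof -
    have "?m (\<lambda>z. \<Sum>k<N. a k * monom_disc k z) = (\<lambda>z. \<Sum>k<N. a k * ?m (monom_disc k) z)"
      by (simp add: sum_distrib_left mult_ac)
    hence "h2_inner (?m (\<lambda>z. \<Sum>k<N. a k * monom_disc k z)) p
        = h2_inner (\<lambda>z. \<Sum>k<N. a k * ?m (monom_disc k) z) p"
      by (simp only:)
    also have "\<dots> = (\<Sum>k<N. h2_inner (\<lambda>z. a k * ?m (monom_disc k) z) p)"
      by (intro h2_inner_sum_left H2_cmult H monom_disc_H2 that)
    also have "\<dots> = (\<Sum>k<N. a k * h2_inner (?m (monom_disc k)) p)"
      by (intro sum.cong refl h2_inner_cmult_left H monom_disc_H2 that)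
    finally show ?thesis .
  qed
  define b where "b = (\<lambda>k. h2_inner f (?m (monom_disc k)))"
  have b': "h2_inner (?m (monom_disc k)) f = cnj (b k)" for k
    unfolding b_def by (intro h2_inner_commute assms H monom_disc_H2)
  have Bessel: "(\<Sum>k<N. (cmod (b k))\<^sup>2) \<le> (h2_norm f)\<^sup>2" for N
  proof -
    \<comment> \<open>For the partial sum \<open>q\<close> of the future g, both the inner product
      of \<theta> q with f and the squared norm of \<theta> q equal \<open>S\<close>. Cauchy-Schwarz
      then reads S \<le> sqrt S times the norm of f.\<close>
    define S where "S = (\<Sum>k<N. (cmod (b k))\<^sup>2)"
    have S0: "S \<ge> 0" unfolding S_def by (intro sum_nonneg) auto
    define q where "q = (\<lambda>z. \<Sum>k<N. b k * monom_disc k z)"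
    have qH: "q \<in> H2" unfolding q_def by (intro H2_sum H2_cmult monom_disc_H2)
    have qf: "h2_inner (?m q) f = of_real S"
      unfolding q_def sum_m[OF assms(2)] b' S_def by (simp add: complex_norm_square[symmetric] del: of_real_power)
    have "h2_inner q q = (\<Sum>k<N. b k * h2_inner (monom_disc k) q)"
      by (subst (1) q_def, subst h2_inner_sum_left) (auto intro!: H2_cmult monom_disc_H2 qH simp: h2_inner_cmult_left monom_disc_H2 qH)
    also have "\<dots> = (\<Sum>k<N. b k * cnj (b k))"
    proof (intro sum.cong refl arg_cong2[of _ _ _ _ "(*)"])
      fix k assume "k \<in> {..<N}"
      have "h2_inner q (monom_disc k) = (\<Sum>j<N. b j * h2_inner (monom_disc j) (monom_disc k))"
        by (subst (1) q_def, subst h2_inner_sum_left) (auto intro!: H2_cmult monom_disc_H2 simp: h2_inner_cmult_left monom_disc_H2)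
      also have "\<dots> = b k"
        using \<open>k \<in> {..<N}\<close> by (simp add: h2_inner_monom_disc tcoeff_monom_disc if_distrib[of "\<lambda>c. _ * c"] cong: if_cong)
      finally show "h2_inner (monom_disc k) q = cnj (b k)"
        using h2_inner_commute[OF qH monom_disc_H2] by simp
    qed
    also have "\<dots> = of_real S"
      by (simp add: S_def complex_norm_square[symmetric] del: of_real_power)
    finally have "(h2_norm q)\<^sup>2 = S"
      by (simp add: h2_inner_self[OF qH] del: of_real_power)
    moreover have "(h2_norm (?m q))\<^sup>2 = (h2_norm q)\<^sup>2"
      using inner_fn_isometry[OF assms(1) qH qH] h2_inner_self[OF qH] h2_inner_self[OF H[OF qH]]
      by (simp del: of_real_power)
    ultimately have "h2_norm (?m q) = sqrt S"
      using h2_norm_nonneg[OF H[OF qH]] by (simp add: real_sqrt_unique)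
    moreover have "S \<le> h2_norm (?m q) * h2_norm f"
      using h2_Cauchy_Schwarz[OF H[OF qH] assms(2)] S0 by (simp add: qf)
    ultimately have le: "sqrt S * sqrt S \<le> sqrt S * h2_norm f"
      using S0 by simp
    have "sqrt S \<le> h2_norm f"
    proof (cases "S = 0")
      case True thus ?thesis using h2_norm_nonneg[OF assms(2)] by simp
    next
      case False
      hence "sqrt S > 0" using S0 by simp
      with le show ?thesis by (simp only: mult_le_cancel_left_pos)
    qed
    hence "S \<le> (h2_norm f)\<^sup>2" by (rule sqrt_le_D)
    thus ?thesis by (simp add: S_def)
  qed
  have bs: "summable (\<lambda>k. (cmod (b k))\<^sup>2)"
    by (rule summableI_nonneg_bounded[OF _ Bessel]) simp
  define g where "g = powser_disc b"
  have gH: "g \<in> H2" unfolding g_def by (rule powser_disc_H2[OF bs])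
  define p where "p = (\<lambda>z. f z - \<theta> z * g z)"
  have pH: "p \<in> H2" unfolding p_def by (intro H2_diff assms H gH)
  have orth: "h2_inner (?m (monom_disc k)) p = 0" for k
  proof -
    have "h2_inner p (?m (monom_disc k)) = 0"
      unfolding p_def h2_inner_diff_left[OF assms(2) H[OF gH] H[OF monom_disc_H2]]
        inner_fn_isometry[OF assms(1) gH monom_disc_H2] h2_inner_monom_disc
      unfolding g_def tcoeff_powser_disc[OF bs] by (simp add: b_def)
    thus ?thesis using h2_inner_commute[OF pH H[OF monom_disc_H2]] by simp
  qed
  have "h2_inner p (?m h) = 0" if h: "h \<in> H2" for h
  proof -
    have "(\<lambda>N. h2_inner (?m (trunc N h)) p) \<longlonglongrightarrow> h2_inner (?m h) p"
      by (intro h2_inner_tendsto H trunc_H2 that pH Hinf_mult_tendsto u trunc_tendsto)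
    hence "h2_inner (?m h) p = 0"
      unfolding trunc_eq_sum sum_m[OF pH] orth by (simp add: LIMSEQ_const_iff)
    thus ?thesis using h2_inner_commute[OF H[OF h] pH] by simp
  qed
  hence "p \<in> model_space \<theta>" using pH by (simp add: model_space_def)
  thus ?thesis using gH by (auto simp: p_def)
qed

text \<open>For members of \<open>H\<^sup>2\<close> this is congruence modulo \<open>\<theta> H\<^sup>2\<close>.\<close>

definition model_cong :: "(complex \<Rightarrow> complex) \<Rightarrow> (complex \<Rightarrow> complex) \<Rightarrow> (complex \<Rightarrow> complex) \<Rightarrow> bool" where
  "model_cong \<theta> f g \<longleftrightarrow> (\<forall>k\<in>model_space \<theta>. h2_inner f k = h2_inner g k)"

text \<open>The difference lies in the model space and is orthogonal to it.\<close>

lemma model_cong_eq: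
  assumes "\<theta> \<in> Hinf" "f \<in> model_space \<theta>" "g \<in> model_space \<theta>" "model_cong \<theta> f g"
  shows "f = g"
proof -
  let ?d = "\<lambda>z. f z - g z"
  have d: "?d \<in> model_space \<theta>" by (intro model_space_diff assms)
  have "h2_inner ?d ?d = h2_inner f ?d - h2_inner g ?d"
    by (intro h2_inner_diff_left model_space_H2[OF d] model_space_H2[OF assms(2)] model_space_H2[OF assms(3)])
  also have "\<dots> = 0" using assms(4) d by (simp add: model_cong_def)
  finally have "h2_inner ?d ?d = 0" .
  hence "h2_norm ?d = 0" using h2_inner_self[OF model_space_H2[OF d]] by simp
  hence "?d = (\<lambda>z. 0)" by (rule h2_norm_eq_0[OF model_space_H2[OF d]])
  thus ?thesis by (simp add: fun_eq_iff)
qed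

text \<open>\<open>h2_proj\<close> is a definite description: the decomposition above gives
  existence and \<open>model_cong_eq\<close> uniqueness.\<close>

lemma h2_proj_model_space:
  assumes "inner_fn \<theta>" "f \<in> H2"
  shows "h2_proj (model_space \<theta>) f \<in> model_space \<theta>" "model_cong \<theta> (h2_proj (model_space \<theta>) f) f"
proof -
  have u: "\<theta> \<in> Hinf" using assms(1) by (simp add: inner_fn_def)
  let ?P = "\<lambda>p. p \<in> model_space \<theta> \<and> (\<forall>k\<in>model_space \<theta>. h2_inner (\<lambda>z. f z - p z) k = 0)"
  have eq: "?P p \<longleftrightarrow> p \<in> model_space \<theta> \<and> model_cong \<theta> p f" for p
    using assms(2) by (auto simp: model_cong_def h2_inner_diff_left model_space_H2)
  obtain g where g: "g \<in> H2" "(\<lambda>z. f z - \<theta> z * g z) \<in> model_space \<theta>"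
    using model_space_decomposition[OF assms] by blast
  have P: "?P (\<lambda>z. f z - \<theta> z * g z)"
    using g model_space_orth[OF u _ g(1)] by simp
  have Q: "p = q" if "?P p" "?P q" for p q
    using that unfolding eq by (intro model_cong_eq[OF u]) (auto simp: model_cong_def)
  have "?P (h2_proj (model_space \<theta>) f)"
    unfolding h2_proj_def by (rule theI[of ?P, OF P]) (rule Q[OF _ P])
  thus "h2_proj (model_space \<theta>) f \<in> model_space \<theta>" "model_cong \<theta> (h2_proj (model_space \<theta>) f) f"
    unfolding eq by auto
qed

text \<open>The space \<theta> \<open>H2\<close> is invariant under \<open>Hinf\<close>. Subtracting
  \<theta> h from f - g leaves an element of the model space that is orthogonal to it, so f - g =
  \<theta> h exactly and u (f - g) = \<theta> (u h).\<close>

lemma model_cong_mult: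
  assumes "inner_fn \<theta>" "u \<in> Hinf" "f \<in> H2" "g \<in> H2" "model_cong \<theta> f g"
  shows "model_cong \<theta> (\<lambda>z. u z * f z) (\<lambda>z. u z * g z)"
proof -
  have t: "\<theta> \<in> Hinf" using assms(1) by (simp add: inner_fn_def)
  let ?d = "\<lambda>z. f z - g z"
  obtain h where h: "h \<in> H2" "(\<lambda>z. ?d z - \<theta> z * h z) \<in> model_space \<theta>"
    using model_space_decomposition[OF assms(1) H2_diff[OF assms(3,4)]] by blast
  have "model_cong \<theta> (\<lambda>z. ?d z - \<theta> z * h z) (\<lambda>z. 0)"
    using assms(3-5) h(1) t
    by (simp add: model_cong_def h2_inner_diff_left H2_diff Hinf_mult_H2 model_space_H2 model_space_orth)
  moreover have "(\<lambda>z. 0) \<in> model_space \<theta>" by (simp add: model_space_def H2_zero)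
  ultimately have "(\<lambda>z. ?d z - \<theta> z * h z) = (\<lambda>z. 0)"
    using model_cong_eq[OF t h(2)] by blast
  hence d: "?d z = \<theta> z * h z" for z by (simp add: fun_eq_iff)
  have "u z * f z - u z * g z = \<theta> z * (u z * h z)" for z
  proof -
    have "u z * f z - u z * g z = u z * ?d z" by (simp add: right_diff_distrib)
    also have "\<dots> = \<theta> z * (u z * h z)" unfolding d by simp
    finally show ?thesis .
  qed
  moreover have "h2_inner (\<lambda>z. \<theta> z * (u z * h z)) k = 0" if "k \<in> model_space \<theta>" for k
    by (intro model_space_orth t that Hinf_mult_H2 assms h)
  ultimately have "h2_inner (\<lambda>z. u z * f z - u z * g z) k = 0" if "k \<in> model_space \<theta>" for k
    using that by simp
  thus ?thesis
    using assms(2-4) by (simp add: model_cong_def h2_inner_diff_left Hinf_mult_H2 model_space_H2)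
qed

lemma uS_model_space:
  assumes "inner_fn \<theta>" "u \<in> Hinf" "f \<in> model_space \<theta>"
  shows "uS \<theta> u f \<in> model_space \<theta>" "model_cong \<theta> (uS \<theta> u f) (\<lambda>z. u z * f z)"
  unfolding uS_def
  using h2_proj_model_space[OF assms(1) Hinf_mult_H2[OF assms(2) model_space_H2[OF assms(3)]]] by auto

section \<open>Herglotz majorants and approximate units\<close>

text \<open>In terms of the backward shift \<open>B\<close>, the sequence \<open>g\<close> is \<open>(I - z B)\<^sup>-\<^sup>1 a\<close>.\<close>

lemma resolvent_ell2:
  fixes a :: "nat \<Rightarrow> complex" and z :: complex
  defines "g \<equiv> \<lambda>n. \<Sum>k. a (n + k) * z ^ k"
  assumes "summable (\<lambda>k. (cmod (a k))\<^sup>2)" "cmod z < 1"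
  shows "g n = a n + z * g (Suc n)"
    and "summable (\<lambda>n. (cmod (g n))\<^sup>2)"
    and "sqrt (\<Sum>n. (cmod (g n))\<^sup>2) \<le> sqrt (\<Sum>n. (cmod (a n))\<^sup>2) / (1 - cmod z)\<^sup>2"
proof -
  define A where "A = sqrt (\<Sum>n. (cmod (a n))\<^sup>2)"
  define r where "r = cmod z"
  have r: "0 \<le> r" "r < 1" using assms by (auto simp: r_def)
  have A: "cmod (a k) \<le> A" for k unfolding A_def by (rule ell2_bounded[OF assms(2)])
  have A0: "A \<ge> 0" unfolding A_def using assms(2) by (intro real_sqrt_ge_zero suminf_nonneg) auto
  have sm: "summable (\<lambda>k. cmod (a (n + k) * z ^ k))" for n
    by (rule summable_powser_bounded[OF A assms(3)])
  show rec: "g n = a n + z * g (Suc n)" for n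
  proof -
    have "g n = a n + (\<Sum>k. a (n + Suc k) * z ^ Suc k)"
      using suminf_split_head[OF summable_norm_cancel[OF sm], of n] by (simp add: g_def)
    also have "(\<Sum>k. a (n + Suc k) * z ^ Suc k) = z * g (Suc n)"
      unfolding g_def using suminf_mult[OF summable_norm_cancel[OF sm], of z "Suc n"] by (simp add: mult_ac)
    finally show ?thesis .
  qed
  have gb: "cmod (g n) \<le> A / (1 - r)" for n
  proof -
    have "cmod (g n) \<le> (\<Sum>k. cmod (a (n + k) * z ^ k))"
      unfolding g_def by (rule summable_norm[OF sm])
    also have "\<dots> \<le> (\<Sum>k. A * r ^ k)"
      using r by (intro suminf_le sm summable_mult summable_geometric)
                 (auto simp: norm_mult norm_power r_def[symmetric] intro!: mult_right_mono A)
    also have "\<dots> = A / (1 - r)"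
      using r by (simp add: suminf_mult summable_geometric suminf_geometric)
    finally show ?thesis .
  qed
  \<comment> \<open>The recursion is applied to finite sections, as summability is still open. The
    shifted section exceeds the original one by at most |g N|, for which the pointwise bound A / (1
    - r) is used; absorbing r times the section costs the second factor 1 - r.\<close>
  have L: "L2_set (\<lambda>n. cmod (g n)) {..<N} \<le> A / (1 - r)\<^sup>2" for N
  proof -
    let ?L = "L2_set (\<lambda>n. cmod (g n)) {..<N}"
    have "?L \<le> L2_set (\<lambda>n. cmod (a n) + r * cmod (g (Suc n))) {..<N}"
    proof (rule L2_set_mono)
      show "cmod (g n) \<le> cmod (a n) + r * cmod (g (Suc n))" for n
        using norm_triangle_ineq[of "a n" "z * g (Suc n)"] unfolding rec[of n] by (simp add: norm_mult r_def)
    qed auto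
    also have "\<dots> \<le> L2_set (\<lambda>n. cmod (a n)) {..<N} + L2_set (\<lambda>n. r * cmod (g (Suc n))) {..<N}"
      by (rule L2_set_triangle_ineq)
    also have "L2_set (\<lambda>n. cmod (a n)) {..<N} \<le> A"
      unfolding A_def L2_set_def by (intro real_sqrt_le_mono sum_le_suminf assms) auto
    also have "L2_set (\<lambda>n. r * cmod (g (Suc n))) {..<N} = r * L2_set (\<lambda>n. cmod (g (Suc n))) {..<N}"
      using r by (simp add: L2_set_right_distrib)
    also have "L2_set (\<lambda>n. cmod (g (Suc n))) {..<N} \<le> ?L + cmod (g N)"
    proof -
      have "(L2_set (\<lambda>n. cmod (g (Suc n))) {..<N})\<^sup>2 = (\<Sum>n<N. (cmod (g (Suc n)))\<^sup>2)"
        by (simp add: L2_set_def sum_nonneg)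
      also have "\<dots> \<le> (\<Sum>n<Suc N. (cmod (g n))\<^sup>2)"
        unfolding sum.lessThan_Suc_shift by simp
      also have "\<dots> = ?L\<^sup>2 + (cmod (g N))\<^sup>2"
        by (simp add: L2_set_def sum_nonneg)
      also have "\<dots> \<le> (?L + cmod (g N))\<^sup>2"
        by (simp add: power2_sum)
      finally show ?thesis by (rule power2_le_imp_le) simp
    qed
    also have "cmod (g N) \<le> A / (1 - r)" by (rule gb)
    finally have "?L \<le> A + r * (?L + A / (1 - r))" using r by (simp add: mult_left_mono)
    hence "(1 - r) * ?L \<le> A + r * (A / (1 - r))" by (simp add: algebra_simps)
    also have "\<dots> = A / (1 - r)" using r by (simp add: field_simps)
    finally have "?L \<le> A / (1 - r) / (1 - r)" using r by (simp add: pos_le_divide_eq mult.commute)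
    thus ?thesis by (simp add: power2_eq_square)
  qed
  have S: "(\<Sum>n<N. (cmod (g n))\<^sup>2) \<le> (A / (1 - r)\<^sup>2)\<^sup>2" for N
    using power_mono[OF L[of N], of 2] by (simp add: L2_set_def sum_nonneg)
  show sg: "summable (\<lambda>n. (cmod (g n))\<^sup>2)"
    by (rule summableI_nonneg_bounded[OF _ S]) simp
  have "sqrt (\<Sum>n. (cmod (g n))\<^sup>2) \<le> sqrt ((A / (1 - r)\<^sup>2)\<^sup>2)"
    by (intro real_sqrt_le_mono suminf_le_const[OF sg] S)
  also have "\<dots> = A / (1 - r)\<^sup>2" using A0 by simp
  finally show "sqrt (\<Sum>n. (cmod (g n))\<^sup>2) \<le> sqrt (\<Sum>n. (cmod (a n))\<^sup>2) / (1 - cmod z)\<^sup>2"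
    by (simp add: A_def r_def)
qed

text \<open>With \<open>g = (I - z B)\<^sup>-\<^sup>1 f\<close> as above, \<open>F z = 2 \<langle>g, f\<rangle> - \<parallel>f\<parallel>\<^sup>2\<close> has real part
  \<open>\<parallel>g\<parallel>\<^sup>2 - \<parallel>g - f\<parallel>\<^sup>2 = \<parallel>g\<parallel>\<^sup>2 - |z|\<^sup>2 \<parallel>B g\<parallel>\<^sup>2\<close>, which is at least \<open>|g 0|\<^sup>2 = |f z|\<^sup>2\<close>.\<close>

lemma Herglotz_majorant:
  assumes "f \<in> H2"
  shows "\<exists>F. F holomorphic_on disc \<and> (\<forall>z\<in>disc. (cmod (f z))\<^sup>2 \<le> Re (F z) \<and>
           cmod (F z) \<le> 3 * (h2_norm f)\<^sup>2 / (1 - cmod z)\<^sup>2)"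
proof -
  define a where "a = tcoeff f"
  have a: "summable (\<lambda>k. (cmod (a k))\<^sup>2)" unfolding a_def by (rule H2_summable[OF assms])
  define g where "g = (\<lambda>z n. \<Sum>k. a (n + k) * z ^ k)"
  define F where "F = (\<lambda>z. 2 * (\<Sum>n. g z n * cnj (a n)) - of_real (\<Sum>n. (cmod (a n))\<^sup>2))"
  have norm_f: "(h2_norm f)\<^sup>2 = (\<Sum>n. (cmod (a n))\<^sup>2)" "h2_norm f = sqrt (\<Sum>n. (cmod (a n))\<^sup>2)"
    unfolding a_def by (rule h2_norm_sq[OF assms], rule h2_norm_def)
  have g: "g z n = a n + z * g z (Suc n)" "summable (\<lambda>n. (cmod (g z n))\<^sup>2)"
      "sqrt (\<Sum>n. (cmod (g z n))\<^sup>2) \<le> h2_norm f / (1 - cmod z)\<^sup>2" if "z \<in> disc" for z n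
    using resolvent_ell2[OF a, of z] that unfolding g_def norm_f by (auto simp: mem_disc)
  have A: "cmod (a k) \<le> h2_norm f" for k unfolding norm_f by (rule ell2_bounded[OF a])
  have g0: "g z 0 = f z" if "z \<in> disc" for z
    using sums_tcoeff[OF H2_holomorphic[OF assms] that] by (simp add: g_def a_def sums_iff)
  have g_holo: "(\<lambda>z. g z n) holomorphic_on disc" for n
    unfolding disc_def
  proof (rule power_series_holomorphic)
    fix w :: complex assume "w \<in> ball 0 1"
    hence "summable (\<lambda>k. a (n + k) * w ^ k)"
      by (intro summable_norm_cancel[OF summable_powser_bounded[OF A]]) auto
    thus "(\<lambda>k. a (n + k) * (w - 0) ^ k) sums g w n"
      by (simp add: g_def summable_sums)
  qed
  have "(\<lambda>z. \<Sum>n. g z n * cnj (a n)) holomorphic_on disc"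
  proof (rule holomorphic_uniform_sequence[OF open_disc])
    show "(\<lambda>z. \<Sum>n<N. g z n * cnj (a n)) holomorphic_on disc" for N
      by (intro holomorphic_intros g_holo)
    fix x assume "x \<in> disc"
    hence x: "cmod x < 1" by (simp add: mem_disc)
    define d where "d = (1 - cmod x) / 2"
    define \<rho> where "\<rho> = (1 + cmod x) / 2"
    have \<rho>: "0 \<le> \<rho>" "\<rho> < 1" using x by (auto simp: \<rho>_def)
    have ball: "cmod z \<le> \<rho>" if "z \<in> cball x d" for z
      using that norm_triangle_ineq2[of z x] by (simp add: \<rho>_def d_def dist_norm norm_minus_commute field_simps)
    \<comment> \<open>The resolvent at the real point \<rho>, applied to the moduli of the
      coefficients, dominates \<open>g z\<close> for all |z| \<le> \<rho> and is still square
      summable. It provides the majorant for the M-test.\<close>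
    define b where "b = (\<lambda>k. complex_of_real (cmod (a k)))"
    define G where "G = (\<lambda>n. \<Sum>k. b (n + k) * (of_real \<rho>) ^ k)"
    have G: "summable (\<lambda>n. (cmod (G n))\<^sup>2)"
      unfolding G_def using \<rho> by (intro resolvent_ell2(2)) (auto simp: b_def a)
    have gG: "cmod (g z n) \<le> cmod (G n)" if "z \<in> cball x d" for z n
    proof -
      have z: "cmod z \<le> \<rho>" by (rule ball[OF that])
      have sg: "summable (\<lambda>k. cmod (a (n + k) * z ^ k))"
        using z \<rho> by (intro summable_powser_bounded[OF A]) auto
      have "summable (\<lambda>k. cmod (a (n + k) * (of_real \<rho>) ^ k))"
        using \<rho> by (intro summable_powser_bounded[OF A]) auto
      hence sG: "summable (\<lambda>k. cmod (a (n + k)) * \<rho> ^ k)"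
        using \<rho> by (simp add: norm_mult norm_power)
      have "cmod (g z n) \<le> (\<Sum>k. cmod (a (n + k) * z ^ k))"
        unfolding g_def by (rule summable_norm[OF sg])
      also have "\<dots> \<le> (\<Sum>k. cmod (a (n + k)) * \<rho> ^ k)"
        by (intro suminf_le sg sG) (auto simp: norm_mult norm_power intro!: mult_left_mono power_mono z)
      also have "\<dots> = cmod (of_real (\<Sum>k. cmod (a (n + k)) * \<rho> ^ k))"
        using \<rho> by (auto intro!: abs_of_nonneg[symmetric] suminf_nonneg sG)
      also have "\<dots> = cmod (G n)"
        unfolding G_def b_def using suminf_of_real[OF sG, where 'a = complex] by simp
      finally show ?thesis .
    qed
    have "cball x d \<subseteq> disc" using ball \<rho> by (force simp: mem_disc)
    moreover have "uniform_limit (cball x d) (\<lambda>N z. \<Sum>n<N. g z n * cnj (a n)) (\<lambda>z. \<Sum>n. g z n * cnj (a n)) sequentially"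
    proof (rule Weierstrass_m_test)
      show "norm (g z n * cnj (a n)) \<le> cmod (G n) * cmod (a n)" if "z \<in> cball x d" for n z
        using gG[OF that] by (simp add: norm_mult mult_right_mono)
      show "summable (\<lambda>n. cmod (G n) * cmod (a n))" by (rule summable_sq_mult[OF G a])
    qed
    moreover have "0 < d" using x by (simp add: d_def)
    ultimately show "\<exists>d>0. cball x d \<subseteq> disc \<and>
        uniform_limit (cball x d) (\<lambda>N z. \<Sum>n<N. g z n * cnj (a n)) (\<lambda>z. \<Sum>n. g z n * cnj (a n)) sequentially"
      by blast
  qed
  hence "F holomorphic_on disc"
    unfolding F_def by (intro holomorphic_intros)
  moreover have "(cmod (f z))\<^sup>2 \<le> Re (F z)" if z: "z \<in> disc" for z
  proof -
    have s1: "(\<lambda>n. g z n * cnj (a n)) sums (\<Sum>n. g z n * cnj (a n))"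
      by (intro summable_sums summable_sq_cnj g z a)
    have "(\<lambda>n. 2 * Re (g z n * cnj (a n)) - (cmod (a n))\<^sup>2) sums (2 * Re (\<Sum>n. g z n * cnj (a n)) - (\<Sum>n. (cmod (a n))\<^sup>2))"
      by (intro sums_diff sums_mult sums_Re s1 summable_sums a)
    moreover have "2 * Re (g z n * cnj (a n)) - (cmod (a n))\<^sup>2 = (cmod (g z n))\<^sup>2 - (cmod z)\<^sup>2 * (cmod (g z (Suc n)))\<^sup>2" for n
    proof -
      have "z * g z (Suc n) = g z n - a n" using g(1)[OF z, of n] by simp
      hence "(cmod z)\<^sup>2 * (cmod (g z (Suc n)))\<^sup>2 = (cmod (g z n - a n))\<^sup>2"
        by (metis norm_mult power_mult_distrib)
      also have "\<dots> = (cmod (g z n))\<^sup>2 - 2 * Re (g z n * cnj (a n)) + (cmod (a n))\<^sup>2"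
        unfolding cmod_power2 by (simp add: power2_eq_square algebra_simps)
      finally show ?thesis by simp
    qed
    ultimately have "(\<lambda>n. (cmod (g z n))\<^sup>2 - (cmod z)\<^sup>2 * (cmod (g z (Suc n)))\<^sup>2) sums Re (F z)"
      by (simp add: F_def)
    moreover have "(\<lambda>n. (cmod (g z n))\<^sup>2 - (cmod z)\<^sup>2 * (cmod (g z (Suc n)))\<^sup>2) sums
        ((\<Sum>n. (cmod (g z n))\<^sup>2) - (cmod z)\<^sup>2 * (\<Sum>n. (cmod (g z (Suc n)))\<^sup>2))"
      using summable_Suc_iff[THEN iffD2, OF g(2)[OF z]]
      by (intro sums_diff sums_mult summable_sums g z)
    ultimately have "Re (F z) = (\<Sum>n. (cmod (g z n))\<^sup>2) - (cmod z)\<^sup>2 * (\<Sum>n. (cmod (g z (Suc n)))\<^sup>2)"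
      by (rule sums_unique2)
    also have "(\<Sum>n. (cmod (g z n))\<^sup>2) = (cmod (g z 0))\<^sup>2 + (\<Sum>n. (cmod (g z (Suc n)))\<^sup>2)"
      using suminf_split_head[OF g(2)[OF z]] by simp
    finally have eq: "Re (F z) = (cmod (g z 0))\<^sup>2 + (1 - (cmod z)\<^sup>2) * (\<Sum>n. (cmod (g z (Suc n)))\<^sup>2)"
      by (simp add: algebra_simps)
    have "(\<Sum>n. (cmod (g z (Suc n)))\<^sup>2) \<ge> 0"
      using summable_Suc_iff[THEN iffD2, OF g(2)[OF z]] by (intro suminf_nonneg) auto
    moreover have "(cmod z)\<^sup>2 \<le> 1" using z by (simp add: mem_disc power_le_one)
    ultimately show ?thesis unfolding eq g0[OF z, symmetric] by simp
  qed
  moreover have "cmod (F z) \<le> 3 * (h2_norm f)\<^sup>2 / (1 - cmod z)\<^sup>2" if z: "z \<in> disc" for z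
  proof -
    let ?n = "h2_norm f" and ?t = "(1 - cmod z)\<^sup>2"
    have n0: "?n \<ge> 0" by (rule h2_norm_nonneg[OF assms])
    have t: "0 < ?t" "?t \<le> 1" using z by (auto simp: mem_disc power_le_one)
    have "cmod (\<Sum>n. g z n * cnj (a n)) \<le> sqrt (\<Sum>n. (cmod (g z n))\<^sup>2) * ?n"
      unfolding norm_f by (intro Cauchy_Schwarz_suminf g z a)
    also have "\<dots> \<le> ?n / ?t * ?n" by (intro mult_right_mono g z n0)
    finally have 1: "cmod (\<Sum>n. g z n * cnj (a n)) \<le> ?n\<^sup>2 / ?t" by (simp add: power2_eq_square)
    have "?n\<^sup>2 * ?t \<le> ?n\<^sup>2 * 1" using t by (intro mult_left_mono) auto
    hence 2: "?n\<^sup>2 \<le> ?n\<^sup>2 / ?t" using t by (simp add: pos_le_divide_eq)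
    \<comment> \<open>The constant 3 is 2 from the doubled inner product plus 1 from the subtracted
      squared norm.\<close>
    have "cmod (F z) \<le> cmod (2 * (\<Sum>n. g z n * cnj (a n))) + cmod (of_real (?n\<^sup>2))"
      unfolding F_def norm_f(1) by (rule norm_triangle_ineq4)
    also have "\<dots> = 2 * cmod (\<Sum>n. g z n * cnj (a n)) + ?n\<^sup>2" by (simp add: norm_mult norm_power)
    also have "\<dots> \<le> 3 * (?n\<^sup>2 / ?t)" using 1 2 by linarith
    finally show ?thesis by simp
  qed
  ultimately show ?thesis by blast
qed

text \<open>Majorants are added: their real parts are nonnegative, so the sum dominates each of
  them, and a single multiplier can bound the whole family. The constant 12 is 3 / (1 -
  1/2)^2.\<close>

lemma Herglotz_majorant_family:
  assumes "finite I" "\<And>i. i \<in> I \<Longrightarrow> f i \<in> H2"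
  obtains F where "F holomorphic_on disc" "\<And>z. z \<in> disc \<Longrightarrow> 0 \<le> Re (F z)"
    "\<And>i z. i \<in> I \<Longrightarrow> z \<in> disc \<Longrightarrow> (cmod (f i z))\<^sup>2 \<le> Re (F z)"
    "\<And>z. z \<in> ball 0 (1/2) \<Longrightarrow> cmod (F z) \<le> 12 * (\<Sum>i\<in>I. (h2_norm (f i))\<^sup>2)"
proof -
  have "\<forall>i\<in>I. \<exists>F. F holomorphic_on disc \<and> (\<forall>z\<in>disc. (cmod (f i z))\<^sup>2 \<le> Re (F z) \<and>
           cmod (F z) \<le> 3 * (h2_norm (f i))\<^sup>2 / (1 - cmod z)\<^sup>2)"
    using Herglotz_majorant assms(2) by blast
  then obtain F where F: "\<And>i. i \<in> I \<Longrightarrow> F i holomorphic_on disc"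
      "\<And>i z. i \<in> I \<Longrightarrow> z \<in> disc \<Longrightarrow> (cmod (f i z))\<^sup>2 \<le> Re (F i z)"
      "\<And>i z. i \<in> I \<Longrightarrow> z \<in> disc \<Longrightarrow> cmod (F i z) \<le> 3 * (h2_norm (f i))\<^sup>2 / (1 - cmod z)\<^sup>2"
    by (metis (no_types, lifting))
  have nn: "0 \<le> Re (F i z)" if "i \<in> I" "z \<in> disc" for i z
    using F(2)[OF that] by (rule order_trans[rotated]) simp
  show ?thesis
  proof (rule that[of "\<lambda>z. \<Sum>i\<in>I. F i z"])
    show "(\<lambda>z. \<Sum>i\<in>I. F i z) holomorphic_on disc" by (intro holomorphic_intros F)
    show "0 \<le> Re (\<Sum>i\<in>I. F i z)" if "z \<in> disc" for z
      unfolding Re_sum by (intro sum_nonneg nn that)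
    show "(cmod (f i z))\<^sup>2 \<le> Re (\<Sum>i\<in>I. F i z)" if "i \<in> I" "z \<in> disc" for i z
    proof -
      have "Re (F i z) \<le> (\<Sum>i\<in>I. Re (F i z))"
        by (rule member_le_sum) (use that assms(1) nn in auto)
      thus ?thesis using F(2)[OF that] by simp
    qed
    show "cmod (\<Sum>i\<in>I. F i z) \<le> 12 * (\<Sum>i\<in>I. (h2_norm (f i))\<^sup>2)" if "z \<in> ball 0 (1/2)" for z
      unfolding sum_distrib_left
    proof (rule sum_norm_le)
      fix i assume i: "i \<in> I"
      have z: "cmod z < 1/2" using that by simp
      have "(1/2)\<^sup>2 \<le> (1 - cmod z)\<^sup>2" using z by (intro power_mono) auto
      hence "1/4 \<le> (1 - cmod z)\<^sup>2" by (simp add: power2_eq_square)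
      hence "3 * (h2_norm (f i))\<^sup>2 / (1 - cmod z)\<^sup>2 \<le> 3 * (h2_norm (f i))\<^sup>2 / (1/4)"
        by (intro divide_left_mono) auto
      with F(3)[OF i, of z] z show "cmod (F i z) \<le> 12 * (h2_norm (f i))\<^sup>2"
        by (simp add: mem_disc)
    qed
  qed
qed

section \<open>The multipliers 1 / (1 + F/s)\<close>

definition damp :: "(complex \<Rightarrow> complex) \<Rightarrow> real \<Rightarrow> complex \<Rightarrow> complex" where
  "damp F s z = 1 / (1 + F z / of_real s)"

lemma damp_denominator:
  assumes "0 \<le> Re (F z)" "s > 0"
  shows "1 + Re (F z) / s \<le> cmod (1 + F z / of_real s)"
  using complex_Re_le_cmod[of "1 + F z / of_real s"] assms by simp

lemma cmod_damp_le_1: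
  assumes "0 \<le> Re (F z)" "s > 0"
  shows "cmod (damp F s z) \<le> 1"
proof -
  have "1 \<le> 1 + Re (F z) / s" using assms by simp
  also have "\<dots> \<le> cmod (1 + F z / of_real s)" by (rule damp_denominator[where F = F, OF assms])
  finally show ?thesis by (simp add: damp_def norm_divide divide_le_eq)
qed

lemma damp_Hinf:
  assumes "F holomorphic_on disc" "\<And>z. z \<in> disc \<Longrightarrow> 0 \<le> Re (F z)" "s > 0"
  shows "damp F s \<in> Hinf"
proof -
  have "1 + F z / of_real s \<noteq> 0" if "z \<in> disc" for z
  proof -
    have "0 < cmod (1 + F z / of_real s)"
      using damp_denominator[where F = F, OF assms(2)[OF that] assms(3)]
        divide_nonneg_pos[OF assms(2)[OF that] assms(3)] by linarith
    thus ?thesis by simp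
  qed
  hence "(\<lambda>z. 1 / (1 + F z / of_real s)) holomorphic_on disc"
    using assms by (intro holomorphic_intros) auto
  moreover have "bounded (damp F s ` disc)"
    using cmod_damp_le_1[where F = F, OF assms(2) assms(3)] by (auto simp: bounded_iff intro!: exI[of _ 1])
  ultimately show ?thesis by (simp add: Hinf_def damp_def[abs_def])
qed

text \<open>The elementary inequality x \<le> (s + 1) (1 + x^2 / s), split at x = 1. It is
  deliberately crude: mere boundedness for each s is needed, together with the value 2 at s =
  1.\<close>

lemma damp_mult_bounded:
  assumes "(cmod w)\<^sup>2 \<le> Re (F z)" "s > 0"
  shows "cmod (damp F s z * w) \<le> s + 1"
proof -
  let ?x = "cmod w"
  have p: "0 \<le> Re (F z)" using assms(1) by (rule order_trans[rotated]) simp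
  have "?x \<le> (s + 1) * (1 + ?x\<^sup>2 / s)"
  proof (cases "?x \<le> 1")
    case True
    also have "1 = 1 * (1::real)" by simp
    also have "\<dots> \<le> (s + 1) * (1 + ?x\<^sup>2 / s)"
      using assms(2) by (intro mult_mono) auto
    finally show ?thesis .
  next
    case False
    hence "?x * 1 \<le> ?x * ?x" by (intro mult_left_mono) auto
    hence "?x \<le> ?x\<^sup>2" by (simp add: power2_eq_square)
    also have "\<dots> = s * (?x\<^sup>2 / s)" using assms(2) by simp
    also have "\<dots> \<le> (s + 1) * (1 + ?x\<^sup>2 / s)"
      using assms(2) by (intro mult_mono) auto
    finally show ?thesis .
  qed
  also have "\<dots> \<le> (s + 1) * (1 + Re (F z) / s)"
    using assms by (intro mult_left_mono add_left_mono divide_right_mono) auto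
  also have "\<dots> \<le> (s + 1) * cmod (1 + F z / of_real s)"
    using damp_denominator[where F = F, OF p assms(2)] assms(2) by (intro mult_left_mono) auto
  finally have le: "?x \<le> (s + 1) * cmod (1 + F z / of_real s)" .
  have "0 < cmod (1 + F z / of_real s)"
    using damp_denominator[where F = F, OF p assms(2)] divide_nonneg_pos[OF p assms(2)] by linarith
  thus ?thesis using le by (simp add: damp_def norm_mult norm_divide divide_le_eq)
qed

lemma damp_minus_1:
  assumes "0 \<le> Re (F z)" "s > 0"
  shows "cmod (damp F s z - 1) \<le> cmod (F z) / s"
proof -
  have "0 < cmod (1 + F z / of_real s)"
    using damp_denominator[where F = F, OF assms] divide_nonneg_pos[OF assms] by linarith
  hence "1 + F z / of_real s \<noteq> 0" by simp
  hence "damp F s z - 1 = - (damp F s z * (F z / of_real s))"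
    by (simp add: damp_def field_simps)
  hence "cmod (damp F s z - 1) = cmod (damp F s z) * (cmod (F z) / s)"
    using assms(2) by (simp add: norm_mult norm_divide)
  also have "\<dots> \<le> 1 * (cmod (F z) / s)"
    using assms(2) by (intro mult_right_mono cmod_damp_le_1 assms) auto
  finally show ?thesis by simp
qed

text \<open>Uniform convergence on a small disc suffices: it gives convergence of every Taylor coefficient at 0,
  and the bound \<open>C\<close> upgrades this to weak convergence in \<open>H\<^sup>2\<close>.\<close>

definition approx_unit :: "(nat \<Rightarrow> complex \<Rightarrow> complex) \<Rightarrow> bool" where
  "approx_unit q \<longleftrightarrow> (\<forall>k. q k \<in> Hinf) \<and> (\<exists>C. \<forall>k. \<forall>z\<in>disc. cmod (q k z) \<le> C) \<and>
     uniform_limit (ball 0 (1/2)) q (\<lambda>_. 1) sequentially"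

lemma approx_unit_damp:
  assumes "F holomorphic_on disc" "\<And>z. z \<in> disc \<Longrightarrow> 0 \<le> Re (F z)"
    "\<And>z. z \<in> ball 0 (1/2) \<Longrightarrow> cmod (F z) \<le> K"
  shows "approx_unit (\<lambda>k. damp F (real (Suc k)))"
  unfolding approx_unit_def
proof (intro conjI allI)
  show "damp F (real (Suc k)) \<in> Hinf" for k by (rule damp_Hinf[OF assms(1,2)]) auto
  show "\<exists>C. \<forall>k. \<forall>z\<in>disc. cmod (damp F (real (Suc k)) z) \<le> C"
    by (intro exI[of _ 1] allI ballI cmod_damp_le_1 assms(2)) auto
  have "(\<lambda>k. K / real (Suc k)) \<longlonglongrightarrow> 0" by real_asymp
  show "uniform_limit (ball 0 (1/2)) (\<lambda>k. damp F (real (Suc k))) (\<lambda>_. 1) sequentially"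
  proof (rule uniform_limitI)
    fix e :: real assume "e > 0"
    have "\<forall>\<^sub>F k in sequentially. K / real (Suc k) < e"
      using order_tendstoD(2)[OF \<open>(\<lambda>k. K / real (Suc k)) \<longlonglongrightarrow> 0\<close> \<open>e > 0\<close>] .
    thus "\<forall>\<^sub>F k in sequentially. \<forall>z\<in>ball 0 (1/2). dist (damp F (real (Suc k)) z) 1 < e"
    proof eventually_elim
      case (elim k)
      show ?case
      proof
        fix z :: complex assume z: "z \<in> ball 0 (1/2)"
        hence "z \<in> disc" by (auto simp: mem_disc)
        hence "cmod (damp F (real (Suc k)) z - 1) \<le> cmod (F z) / real (Suc k)"
          by (intro damp_minus_1 assms(2)) auto
        also have "\<dots> \<le> K / real (Suc k)" by (intro divide_right_mono assms(3) z) auto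
        finally show "dist (damp F (real (Suc k)) z) 1 < e" using elim by (simp add: dist_norm)
      qed
    qed
  qed
qed

lemma approx_unit_tendsto:
  assumes q: "approx_unit q" and f: "f \<in> H2" and h: "h \<in> H2"
  shows "(\<lambda>k. h2_inner (\<lambda>z. q k z * f z) h) \<longlonglongrightarrow> h2_inner f h"
proof -
  have qH: "q k \<in> Hinf" for k using q by (simp add: approx_unit_def)
  obtain C where C: "\<And>k z. z \<in> disc \<Longrightarrow> cmod (q k z) \<le> C"
    using q unfolding approx_unit_def by blast
  have C0: "C \<ge> 0" using C[OF zero_in_disc] norm_ge_zero order_trans by blast
  let ?g = "\<lambda>k z. q k z * f z"
  have gH: "?g k \<in> H2" for k by (rule Hinf_mult_H2[OF qH f])
  have coeff: "(\<lambda>k. tcoeff (?g k) m) \<longlonglongrightarrow> tcoeff f m" for m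
  proof -
    have sub: "cball 0 (1/2) \<subseteq> disc" by (auto simp: mem_disc)
    have "bounded (f ` cball 0 (1/2))"
      by (intro compact_imp_bounded compact_continuous_image compact_cball
          continuous_on_subset[OF holomorphic_on_imp_continuous_on[OF H2_holomorphic[OF f]] sub])
    hence "bounded (f ` ball 0 (1/2))" by (rule bounded_subset) auto
    hence "uniform_limit (ball 0 (1/2)) ?g (\<lambda>z. 1 * f z) sequentially"
      using q unfolding approx_unit_def
      by (intro uniform_lim_mult uniform_limit_const) (auto simp: image_constant_conv)
    moreover have "\<forall>\<^sub>F k in sequentially. ?g k holomorphic_on ball 0 (1/2)"
      by (intro always_eventually allI holomorphic_on_subset[OF H2_holomorphic[OF gH]]) (auto simp: mem_disc)
    ultimately have "(\<lambda>k. (deriv ^^ m) (?g k) 0) \<longlonglongrightarrow> (deriv ^^ m) (\<lambda>z. 1 * f z) 0"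
      by (rule higher_deriv_complex_uniform_limit) auto
    thus ?thesis unfolding tcoeff_def by (intro tendsto_divide) auto
  qed
  let ?d = "\<lambda>k z. ?g k z - f z"
  have dH: "?d k \<in> H2" for k by (intro H2_diff gH f)
  \<comment> \<open>A bound independent of k, so that replacing h by a truncation costs an error
    uniform in k.\<close>
  have dn: "h2_norm (?d k) \<le> (C + 1) * h2_norm f" for k
  proof -
    have "(\<lambda>z. q k z - 1) holomorphic_on disc"
      using qH[of k] by (auto simp: Hinf_def intro!: holomorphic_intros)
    moreover have b: "cmod (q k z - 1) \<le> C + 1" if "z \<in> disc" for z
      using norm_triangle_ineq4[of "q k z" 1] C[OF that, of k] by simp
    ultimately have "(\<lambda>z. q k z - 1) \<in> Hinf"
      unfolding Hinf_def bounded_iff by blast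
    from h2_norm_Hinf_mult[OF this f _ b] C0 show ?thesis by (simp add: left_diff_distrib)
  qed
  have trunc_lim: "(\<lambda>k. h2_inner (?d k) (trunc N h)) \<longlonglongrightarrow> 0" for N
  proof -
    have tr: "h2_inner g (trunc N h) = (\<Sum>m<N. tcoeff g m * cnj (tcoeff h m))" for g
      unfolding h2_inner_def by (subst suminf_finite[of "{..<N}"]) (auto simp: tcoeff_trunc)
    have "(\<lambda>k. (\<Sum>m<N. tcoeff (?g k) m * cnj (tcoeff h m))) \<longlonglongrightarrow> (\<Sum>m<N. tcoeff f m * cnj (tcoeff h m))"
      by (intro tendsto_intros coeff)
    hence "(\<lambda>k. h2_inner (?g k) (trunc N h) - h2_inner f (trunc N h)) \<longlonglongrightarrow> 0"
      unfolding tr by (rule LIM_zero)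
    thus ?thesis by (simp add: h2_inner_diff_left gH f trunc_H2)
  qed
  have "(\<lambda>k. h2_inner (?d k) h) \<longlonglongrightarrow> 0"
  proof (rule LIMSEQ_I)
    fix e :: real assume e: "e > 0"
    let ?B = "(C + 1) * h2_norm f"
    have B0: "?B \<ge> 0" using C0 h2_norm_nonneg[OF f] by simp
    have "(\<lambda>N. ?B * h2_norm (\<lambda>z. trunc N h z - h z)) \<longlonglongrightarrow> 0"
      by (intro tendsto_mult_right_zero trunc_tendsto h)
    hence "\<forall>\<^sub>F N in sequentially. ?B * h2_norm (\<lambda>z. trunc N h z - h z) < e / 2"
      by (rule order_tendstoD(2)) (use e in simp)
    then obtain N where N: "?B * h2_norm (\<lambda>z. trunc N h z - h z) < e / 2"
      using eventually_happens'[OF sequentially_bot] by blast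
    have "\<forall>\<^sub>F k in sequentially. cmod (h2_inner (?d k) (trunc N h)) < e / 2"
      using tendstoD[OF trunc_lim[of N], of "e/2"] e by simp
    then obtain K where K: "\<And>k. k \<ge> K \<Longrightarrow> cmod (h2_inner (?d k) (trunc N h)) < e / 2"
      by (auto simp: eventually_sequentially)
    have "cmod (h2_inner (?d k) h) < e" if "k \<ge> K" for k
    proof -
      let ?t = "\<lambda>z. trunc N h z - h z"
      have tH: "?t \<in> H2" by (intro H2_diff trunc_H2 h)
      \<comment> \<open>Conjugation moves h, its truncation and their difference into the first
        argument, where \<open>h2_inner_diff_left\<close> applies.\<close>
      have "cnj (h2_inner (?d k) h) = cnj (h2_inner (?d k) (trunc N h)) - cnj (h2_inner (?d k) ?t)"
        using h2_inner_diff_left[OF trunc_H2[of N h] h dH[of k]]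
        unfolding h2_inner_commute[OF dH tH, symmetric] h2_inner_commute[OF dH trunc_H2, symmetric]
          h2_inner_commute[OF dH h, symmetric] by simp
      hence "h2_inner (?d k) h = h2_inner (?d k) (trunc N h) - h2_inner (?d k) ?t"
        by (simp only: complex_cnj_diff[symmetric] complex_cnj_cancel_iff)
      hence "cmod (h2_inner (?d k) h) \<le> cmod (h2_inner (?d k) (trunc N h)) + cmod (h2_inner (?d k) ?t)"
        by (simp only: norm_triangle_ineq4)
      also have "cmod (h2_inner (?d k) ?t) \<le> h2_norm (?d k) * h2_norm ?t"
        by (rule h2_Cauchy_Schwarz[OF dH tH])
      also have "\<dots> \<le> ?B * h2_norm ?t"
        by (intro mult_right_mono dn h2_norm_nonneg tH)
      finally show ?thesis using K[OF that] N by linarith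
    qed
    thus "\<exists>no. \<forall>k\<ge>no. cmod (h2_inner (?d k) h - 0) < e" by auto
  qed
  hence "(\<lambda>k. h2_inner (?g k) h - h2_inner f h) \<longlonglongrightarrow> 0"
    by (simp only: h2_inner_diff_left[OF gH f h])
  thus ?thesis by (rule LIM_zero_cancel)
qed

section \<open>Determinants of matrices of bounded holomorphic functions\<close>

lemma Hinf_const: "(\<lambda>z. c) \<in> Hinf"
  by (auto simp: Hinf_def bounded_iff)

lemma Hinf_add:
  assumes "f \<in> Hinf" "g \<in> Hinf"
  shows "(\<lambda>z. f z + g z) \<in> Hinf"
  using assms bounded_plus_comp[of f disc g] by (auto simp: Hinf_def intro!: holomorphic_intros)

lemma Hinf_mult:
  assumes "f \<in> Hinf" "g \<in> Hinf"
  shows "(\<lambda>z. f z * g z) \<in> Hinf"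
proof -
  obtain A B where "\<And>z. z \<in> disc \<Longrightarrow> cmod (f z) \<le> A" "\<And>z. z \<in> disc \<Longrightarrow> cmod (g z) \<le> B"
    using assms unfolding Hinf_def bounded_iff by auto
  hence "cmod (f z * g z) \<le> A * B" if "z \<in> disc" for z
    using that unfolding norm_mult by (intro mult_mono') auto
  hence "bounded ((\<lambda>z. f z * g z) ` disc)" unfolding bounded_iff by blast
  thus ?thesis using assms by (auto simp: Hinf_def intro!: holomorphic_intros)
qed

lemma Hinf_sum: "(\<And>i. i \<in> I \<Longrightarrow> f i \<in> Hinf) \<Longrightarrow> (\<lambda>z. \<Sum>i\<in>I. f i z) \<in> Hinf"
  by (induction I rule: infinite_finite_induct) (auto intro: Hinf_const Hinf_add)

lemma Hinf_prod: "(\<And>i. i \<in> I \<Longrightarrow> f i \<in> Hinf) \<Longrightarrow> (\<lambda>z. \<Prod>i\<in>I. f i z) \<in> Hinf"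
  by (induction I rule: infinite_finite_induct) (auto intro: Hinf_const Hinf_mult)

text \<open>The determinant is taken at each point separately; that it is again bounded and
  holomorphic comes from the expansion over permutations.\<close>

definition fun_det :: "nat \<Rightarrow> (nat \<Rightarrow> nat \<Rightarrow> complex \<Rightarrow> complex) \<Rightarrow> complex \<Rightarrow> complex" where
  "fun_det m a z = Determinant.det (mat m m (\<lambda>(i, j). a i j z))"

lemma fun_det_expand:
  "fun_det m a z = (\<Sum>p | p permutes {0..<m}. signof p * (\<Prod>i = 0..<m. a i (p i) z))"
  unfolding fun_det_def
  by (subst det_def'[of _ m]) (auto intro!: sum.cong prod.cong dest: permutes_in_image)

lemma fun_det_Hinf:
  assumes "\<And>i j. i < m \<Longrightarrow> j < m \<Longrightarrow> a i j \<in> Hinf"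
  shows "fun_det m a \<in> Hinf"
  unfolding fun_det_expand[abs_def]
  by (intro Hinf_sum Hinf_mult Hinf_const Hinf_prod assms) (auto dest: permutes_in_image)

lemma fun_det_bound:
  assumes "\<And>i j. i < m \<Longrightarrow> j < m \<Longrightarrow> cmod (a i j z) \<le> C"
  shows "cmod (fun_det m a z) \<le> fact m * C ^ m"
proof -
  have "cmod (fun_det m a z) \<le> (\<Sum>p | p permutes {0..<m}. C ^ m)"
    unfolding fun_det_expand
  proof (rule sum_norm_le)
    fix p assume "p \<in> {p. p permutes {0..<m}}"
    hence p: "i < m \<Longrightarrow> p i < m" for i by (auto dest: permutes_in_image)
    have "cmod (signof p * (\<Prod>i = 0..<m. a i (p i) z)) = (\<Prod>i = 0..<m. cmod (a i (p i) z))"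
      by (auto simp: norm_mult sign_def prod_norm)
    also have "\<dots> \<le> (\<Prod>i = 0..<m. C)"
      by (intro prod_mono) (auto intro!: assms p)
    finally show "cmod (signof p * (\<Prod>i = 0..<m. a i (p i) z)) \<le> C ^ m" by simp
  qed
  thus ?thesis by (simp add: card_permutations[of "{0..<m}" m])
qed

text \<open>Turns uniform convergence to a constant into an ordinary limit along a product filter,
  where limits of sums and products need no boundedness conditions.\<close>

lemma uniform_limit_const_iff:
  "uniform_limit S f (\<lambda>_. c) F \<longleftrightarrow> ((\<lambda>(k, z). f k z) \<longlongrightarrow> c) (F \<times>\<^sub>F principal S)"
proof -
  have "eventually P (F \<times>\<^sub>F principal S) \<longleftrightarrow> (\<forall>\<^sub>F k in F. \<forall>z\<in>S. P (k, z))" for P :: "_ \<Rightarrow> bool"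
    unfolding eventually_prod_filter eventually_principal
    by (auto elim: eventually_mono intro!: exI[of _ "\<lambda>k. \<forall>z\<in>S. P (k, z)"] exI[of _ "\<lambda>z. z \<in> S"])
  thus ?thesis unfolding uniform_limit_iff tendsto_iff by (simp add: split_def)
qed

lemma fun_det_uniform_limit:
  assumes "\<And>i j. i < m \<Longrightarrow> j < m \<Longrightarrow>
    uniform_limit S (\<lambda>k. A k i j) (\<lambda>_. if i = j then 1 else 0) F"
  shows "uniform_limit S (\<lambda>k. fun_det m (A k)) (\<lambda>_. 1) F"
proof -
  let ?G = "F \<times>\<^sub>F principal S"
  have "((\<lambda>w. \<Sum>p | p permutes {0..<m}. signof p * (\<Prod>i = 0..<m. A (fst w) i (p i) (snd w))) \<longlongrightarrow>
      (\<Sum>p | p permutes {0..<m}. signof p * (\<Prod>i = 0..<m. if i = p i then 1 else 0))) ?G"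
  proof (intro tendsto_intros)
    fix p i assume "p \<in> {p. p permutes {0..<m}}" "i \<in> {0..<m}"
    hence "i < m" "p i < m" by (auto dest: permutes_in_image)
    from assms[OF this] show "((\<lambda>w. A (fst w) i (p i) (snd w)) \<longlongrightarrow> (if i = p i then 1 else 0)) ?G"
      unfolding uniform_limit_const_iff by (simp add: split_def)
  qed
  \<comment> \<open>The limit is the expansion of the identity matrix's determinant, so no
    permutation has to be examined.\<close>
  also have "(\<Sum>p | p permutes {0..<m}. signof p * (\<Prod>i = 0..<m. if i = p i then 1 else 0)) = (1 :: complex)"
  proof -
    have "fun_det m (\<lambda>i j z. if i = j then 1 else 0) 0 = Determinant.det (1\<^sub>m m)"
      unfolding fun_det_def one_mat_def by simp
    thus ?thesis unfolding fun_det_expand by simp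
  qed
  finally show ?thesis
    unfolding uniform_limit_const_iff fun_det_expand by (simp add: split_def)
qed

text \<open>The family b is the pointwise adjugate. Its entries are signed minors, hence
  determinants of \<open>Hinf\<close> functions, and the relation is adj(M) M = det(M) I.\<close>

lemma fun_det_cofactors:
  assumes "\<And>i j. i \<le> n \<Longrightarrow> j \<le> n \<Longrightarrow> a i j \<in> Hinf"
  obtains b where "\<And>i j. i \<le> n \<Longrightarrow> j \<le> n \<Longrightarrow> b i j \<in> Hinf"
    "\<And>i j z. i \<le> n \<Longrightarrow> j \<le> n \<Longrightarrow>
       (\<Sum>k\<le>n. b i k z * a k j z) = (if i = j then fun_det (Suc n) a z else 0)"
proof -
  define M where "M = (\<lambda>z. mat (Suc n) (Suc n) (\<lambda>(i, j). a i j z))"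
  have M: "M z \<in> carrier_mat (Suc n) (Suc n)" for z by (simp add: M_def)
  define b where "b = (\<lambda>i j z. adj_mat (M z) $$ (i, j))"
  have "b i j \<in> Hinf" if "i \<le> n" "j \<le> n" for i j
  proof -
    \<comment> \<open>The adjugate is the transpose of the cofactor matrix: entry (i, j) deletes row
      j and column i, which the conditional successors skip.\<close>
    have "b i j = (\<lambda>z. (-1) ^ (j + i) *
        fun_det n (\<lambda>i' j'. a (if i' < j then i' else Suc i') (if j' < i then j' else Suc j')) z)"
    proof
      fix z
      have "mat_delete (M z) j i = mat n n (\<lambda>(i', j'). a (if i' < j then i' else Suc i') (if j' < i then j' else Suc j') z)"
        unfolding mat_delete_def by (rule eq_matI) (auto simp: M_def)
      thus "b i j z = (-1) ^ (j + i) *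
          fun_det n (\<lambda>i' j'. a (if i' < j then i' else Suc i') (if j' < i then j' else Suc j')) z"
        using that M[of z] by (simp add: b_def adj_mat_def cofactor_def fun_det_def)
    qed
    moreover have "fun_det n (\<lambda>i' j'. a (if i' < j then i' else Suc i') (if j' < i then j' else Suc j')) \<in> Hinf"
      by (intro fun_det_Hinf assms) auto
    ultimately show ?thesis by (simp add: Hinf_mult Hinf_const)
  qed
  moreover have "(\<Sum>k\<le>n. b i k z * a k j z) = (if i = j then fun_det (Suc n) a z else 0)"
    if "i \<le> n" "j \<le> n" for i j z
  proof -
    have "(adj_mat (M z) * M z) $$ (i, j) = (\<Sum>k = 0..<Suc n. b i k z * a k j z)"
      using that adj_mat(1)[OF M[of z]] unfolding times_mat_def scalar_prod_def
      by (auto simp: b_def M_def intro!: sum.cong)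
    moreover have "(adj_mat (M z) * M z) $$ (i, j) = (if i = j then fun_det (Suc n) a z else 0)"
      unfolding adj_mat(3)[OF M] using that by (simp add: fun_det_def M_def)
    moreover have "{0..<Suc n} = {..n}" by auto
    ultimately show ?thesis by simp
  qed
  ultimately show ?thesis by (rule that)
qed

section \<open>The closability property\<close>

lemma model_cong_add:
  assumes "f \<in> H2" "f' \<in> H2" "g \<in> H2" "g' \<in> H2" "model_cong \<theta> f g" "model_cong \<theta> f' g'"
  shows "model_cong \<theta> (\<lambda>z. f z + f' z) (\<lambda>z. g z + g' z)"
  using assms by (simp add: model_cong_def h2_inner_add_left model_space_H2)

lemma model_cong_sum:
  assumes "\<And>i. i \<in> I \<Longrightarrow> f i \<in> H2" "\<And>i. i \<in> I \<Longrightarrow> g i \<in> H2" "\<And>i. i \<in> I \<Longrightarrow> model_cong \<theta> (f i) (g i)"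
  shows "model_cong \<theta> (\<lambda>z. \<Sum>i\<in>I. f i z) (\<lambda>z. \<Sum>i\<in>I. g i z)"
  using assms by (auto simp: model_cong_def h2_inner_sum_left model_space_H2 intro!: sum.cong)

lemma model_cong_trans: "model_cong \<theta> f g \<Longrightarrow> model_cong \<theta> g h \<Longrightarrow> model_cong \<theta> f h"
  by (simp add: model_cong_def)

lemma model_cong_sym: "model_cong \<theta> f g \<Longrightarrow> model_cong \<theta> g f"
  by (simp add: model_cong_def)

lemma model_cong_refl: "model_cong \<theta> f f"
  by (simp add: model_cong_def)

lemma model_space_sum:
  assumes "\<theta> \<in> Hinf" "\<And>i. i \<in> I \<Longrightarrow> f i \<in> model_space \<theta>"
  shows "(\<lambda>z. \<Sum>i\<in>I. f i z) \<in> model_space \<theta>"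
  using assms by (auto simp: model_space_def h2_inner_sum_left Hinf_mult_H2 intro: H2_sum)

definition vsum :: "nat set \<Rightarrow> (nat \<Rightarrow> Defs.vec) \<Rightarrow> Defs.vec" where
  "vsum I x = (\<lambda>j z. \<Sum>i\<in>I. x i j z)"

lemma lin_transf_vsum:
  assumes "lin_transf H D X" "finite I" "\<And>i. i \<in> I \<Longrightarrow> x i \<in> D"
  shows "vsum I x \<in> D \<and> X (vsum I x) = vsum I (\<lambda>i. X (x i))"
  using assms(2,3)
proof (induction I rule: finite_induct)
  case empty
  have z: "vzero \<in> D" "vsmul 0 x = vzero" for x
    using assms(1) by (simp_all add: lin_transf_def vsmul_def vzero_def)
  have "X (vsmul 0 vzero) = vsmul 0 (X vzero)"
    using assms(1) z(1) unfolding lin_transf_def by blast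
  hence "X vzero = vzero" by (simp only: z(2))
  moreover have "vsum {} y = vzero" for y by (simp add: vsum_def vzero_def)
  ultimately show ?case using z(1) by simp
next
  case (insert i I)
  have eq: "vsum (insert i I) y = vadd (y i) (vsum I y)" for y
    using insert.hyps by (simp add: vsum_def vadd_def)
  show ?case
    unfolding eq using insert.IH insert.prems assms(1) unfolding lin_transf_def by (metis insertI1 insertI2)
qed

section \<open>The direct sum of the model spaces\<close>

locale inner_family =
  fixes n :: nat and \<theta> :: "nat \<Rightarrow> complex \<Rightarrow> complex"
  assumes inner: "j \<le> n \<Longrightarrow> inner_fn (\<theta> j)"
begin

lemma theta_Hinf: "j \<le> n \<Longrightarrow> \<theta> j \<in> Hinf"
  using inner by (simp add: inner_fn_def)

lemma DS_component: "x \<in> DS n \<theta> \<Longrightarrow> j \<le> n \<Longrightarrow> x j \<in> model_space (\<theta> j)"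
  by (simp add: DS_def)

lemma DS_H2: "x \<in> DS n \<theta> \<Longrightarrow> j \<le> n \<Longrightarrow> x j \<in> H2"
  using DS_component model_space_H2 by blast

lemma uT_DS:
  assumes "u \<in> Hinf" "x \<in> DS n \<theta>"
  shows "uT n \<theta> u x \<in> DS n \<theta>"
  using assms by (simp add: DS_def uT_def uS_model_space inner)

lemma uT_cong:
  assumes "u \<in> Hinf" "x \<in> DS n \<theta>" "j \<le> n"
  shows "model_cong (\<theta> j) (uT n \<theta> u x j) (\<lambda>z. u z * x j z)"
  using assms by (simp add: uT_def uS_model_space inner DS_component)

text \<open>Allows identities between vectors to be checked on arbitrary \<open>H2\<close>
  representatives of their components modulo \<theta> \<open>H2\<close>; above n both vectors
  vanish.\<close>

lemma DS_eqI:
  assumes "x \<in> DS n \<theta>" "y \<in> DS n \<theta>" "\<And>j. j \<le> n \<Longrightarrow> model_cong (\<theta> j) (x j) (y j)"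
  shows "x = y"
proof
  fix j show "x j = y j"
  proof (cases "j \<le> n")
    case True
    thus ?thesis using assms by (intro model_cong_eq[OF theta_Hinf]) (auto intro: DS_component)
  next
    case False
    thus ?thesis using assms(1,2) by (simp add: DS_def)
  qed
qed

lemma DS_vsum:
  assumes "\<And>i. i \<in> I \<Longrightarrow> x i \<in> DS n \<theta>"
  shows "vsum I x \<in> DS n \<theta>"
proof -
  have "(\<lambda>z. \<Sum>i\<in>I. x i j z) \<in> model_space (\<theta> j)" if "j \<le> n" for j
    using that assms by (intro model_space_sum theta_Hinf DS_component)
  moreover have "(\<lambda>z. \<Sum>i\<in>I. x i j z) = (\<lambda>z. 0)" if "n < j" for j
  proof -
    have "x i j = (\<lambda>z. 0)" if "i \<in> I" for i
      using assms[OF that] \<open>n < j\<close> by (simp add: DS_def)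
    thus ?thesis by simp
  qed
  ultimately show ?thesis by (simp add: DS_def vsum_def)
qed

lemma component_tendsto:
  assumes "\<And>l. s l \<in> DS n \<theta>" "x \<in> DS n \<theta>" "(\<lambda>l. ds_norm n (vsub (s l) x)) \<longlonglongrightarrow> 0" "j \<le> n"
  shows "(\<lambda>l. h2_norm (\<lambda>z. s l j z - x j z)) \<longlonglongrightarrow> 0"
proof (rule Lim_null_comparison[OF always_eventually assms(3)], rule allI)
  fix l
  have "(h2_norm (vsub (s l) x j))\<^sup>2 \<le> (\<Sum>j\<le>n. (h2_norm (vsub (s l) x j))\<^sup>2)"
    by (rule member_le_sum) (use assms(4) in auto)
  hence "\<bar>h2_norm (vsub (s l) x j)\<bar> \<le> ds_norm n (vsub (s l) x)"
    unfolding ds_norm_def by (rule real_le_rsqrt[of "\<bar>_\<bar>", simplified])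
  thus "norm (h2_norm (\<lambda>z. s l j z - x j z)) \<le> ds_norm n (vsub (s l) x)"
    by (simp add: vsub_def)
qed

text \<open>The factor \<open>monom_disc 0\<close> cuts off at the boundary of the disc, since members of \<open>H2\<close> vanish outside it.\<close>

definition approximant :: "real \<Rightarrow> (nat \<Rightarrow> nat \<Rightarrow> complex \<Rightarrow> complex) \<Rightarrow> (nat \<Rightarrow> Defs.vec) \<Rightarrow> bool" where
  "approximant \<epsilon> A c \<longleftrightarrow> (\<forall>i\<le>n. \<forall>j\<le>n. A i j \<in> Hinf \<and> (\<forall>z\<in>disc. cmod (A i j z) \<le> 3) \<and>
     model_cong (\<theta> j) (c i j) (\<lambda>z. A i j z * monom_disc 0 z) \<and>
     (\<forall>z\<in>ball 0 (1/2). cmod (A i j z - (if i = j then 1 else 0)) \<le>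
        12 * (real (Suc n))\<^sup>2 * \<epsilon>\<^sup>2 + sqrt (12 * (real (Suc n))\<^sup>2 * \<epsilon>\<^sup>2)))"

context
  fixes D :: "Defs.vec set" and X :: "Defs.vec \<Rightarrow> Defs.vec"
  assumes lin: "lin_transf (DS n \<theta>) D X"
    and comm: "commutes_with (DS n \<theta>) (ds_norm n) {uT n \<theta> u | u. u \<in> Hinf} D X"
begin

lemma D_DS: "x \<in> D \<Longrightarrow> x \<in> DS n \<theta>"
  using lin unfolding lin_transf_def by blast

lemma X_DS: "x \<in> D \<Longrightarrow> X x \<in> DS n \<theta>"
  using lin unfolding lin_transf_def by blast

lemma uT_D: "uT n \<theta> u x \<in> D" and X_uT: "X (uT n \<theta> u x) = uT n \<theta> u (X x)"
  if "u \<in> Hinf" "x \<in> D"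
proof -
  have "uT n \<theta> u \<in> {uT n \<theta> u | u. u \<in> Hinf}" using that(1) by blast
  moreover have "\<forall>A\<in>{uT n \<theta> u | u. u \<in> Hinf}. \<forall>x\<in>D. A x \<in> D \<and> X (A x) = A (X x)"
    using comm unfolding commutes_with_def by (rule conjunct2)
  ultimately have "uT n \<theta> u x \<in> D \<and> X (uT n \<theta> u x) = uT n \<theta> u (X x)"
    using that(2) by (drule_tac bspec) auto
  thus "uT n \<theta> u x \<in> D" "X (uT n \<theta> u x) = uT n \<theta> u (X x)" by simp_all
qed

section \<open>Cramer's rule for a fixed matrix of lifts\<close>

context
  fixes A :: "nat \<Rightarrow> nat \<Rightarrow> complex \<Rightarrow> complex" and c :: "nat \<Rightarrow> Defs.vec"
  assumes A: "\<And>i j. i \<le> n \<Longrightarrow> j \<le> n \<Longrightarrow> A i j \<in> Hinf"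
    and c: "\<And>i. i \<le> n \<Longrightarrow> c i \<in> D"
    and cA: "\<And>i j. i \<le> n \<Longrightarrow> j \<le> n \<Longrightarrow>
      model_cong (\<theta> j) (c i j) (\<lambda>z. A i j z * monom_disc 0 z)"
begin

text \<open>Cramer's rule needs bounded coefficients, so it is first used for \<open>q x\<close> with an approximate unit \<open>q\<close>
  depending on \<open>x\<close>, which is removed in the limit; \<open>g\<close> only depends on the \<open>X (c i)\<close>.\<close>

lemma transform_formula:
  assumes b: "\<And>i j. i \<le> n \<Longrightarrow> j \<le> n \<Longrightarrow> b i j \<in> Hinf"
      "\<And>i j z. i \<le> n \<Longrightarrow> j \<le> n \<Longrightarrow>
         (\<Sum>k\<le>n. b i k z * A k j z) = (if i = j then fun_det (Suc n) A z else 0)"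
    and x: "x \<in> D" and k: "k \<le> n" and g: "g \<in> Hinf"
    and gc: "\<And>i. i \<le> n \<Longrightarrow> (\<lambda>z. g z * X (c i) k z) \<in> Hinf"
    and h: "h \<in> model_space (\<theta> k)"
  shows "h2_inner (\<lambda>z. g z * (fun_det (Suc n) A z * X x k z)) h =
     h2_inner (\<lambda>z. \<Sum>j\<le>n. (\<Sum>i\<le>n. b j i z * (g z * X (c i) k z)) * x j z) h"
proof -
  let ?\<delta> = "fun_det (Suc n) A"
  let ?L = "\<lambda>z. g z * (?\<delta> z * X x k z)"
  let ?R = "\<lambda>z. \<Sum>j\<le>n. (\<Sum>i\<le>n. b j i z * (g z * X (c i) k z)) * x j z"
  have hH: "h \<in> H2" by (rule model_space_H2[OF h])
  have \<delta>: "?\<delta> \<in> Hinf" by (intro fun_det_Hinf A) auto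
  have xH: "x j \<in> H2" if "j \<le> n" for j by (rule DS_H2[OF D_DS[OF x] that])
  have XH: "X x j \<in> H2" if "j \<le> n" for j by (rule DS_H2[OF X_DS[OF x] that])
  have XcH: "X (c i) j \<in> H2" if "i \<le> n" "j \<le> n" for i j by (rule DS_H2[OF X_DS[OF c[OF that(1)]] that(2)])
  have cH: "c i j \<in> H2" if "i \<le> n" "j \<le> n" for i j by (rule DS_H2[OF D_DS[OF c[OF that(1)]] that(2)])
  have LH: "?L \<in> H2" by (intro Hinf_mult_H2 g \<delta> XH k)
  have RH: "?R \<in> H2" by (intro H2_sum Hinf_mult_H2 Hinf_sum Hinf_mult b gc xH) auto
  \<comment> \<open>A majorant of the components of \<open>x\<close>: the multiplier
    \<open>q\<close> below makes all q x j bounded, so that they may enter the symbols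
    \<open>U i\<close>.\<close>
  obtain F where F: "F holomorphic_on disc" "\<And>z. z \<in> disc \<Longrightarrow> 0 \<le> Re (F z)"
    "\<And>i z. i \<in> {..n} \<Longrightarrow> z \<in> disc \<Longrightarrow> (cmod (x i z))\<^sup>2 \<le> Re (F z)"
    "\<And>z. z \<in> ball 0 (1/2) \<Longrightarrow> cmod (F z) \<le> 12 * (\<Sum>i\<in>{..n}. (h2_norm (x i))\<^sup>2)"
    using Herglotz_majorant_family[of "{..n}" x] xH by (metis atMost_iff finite_atMost)
  have au: "approx_unit (\<lambda>s. damp F (real (Suc s)))"
    by (rule approx_unit_damp[OF F(1,2,4)])
  have "h2_inner (\<lambda>z. damp F (real (Suc s)) z * ?L z) h = h2_inner (\<lambda>z. damp F (real (Suc s)) z * ?R z) h" for s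
  proof -
    define q where "q = damp F (real (Suc s))"
    have q: "q \<in> Hinf" unfolding q_def by (rule damp_Hinf[OF F(1,2)]) auto
    have qx: "(\<lambda>z. q z * x j z) \<in> Hinf" if "j \<le> n" for j
    proof -
      have "cmod (q z * x j z) \<le> real (Suc s) + 1" if "z \<in> disc" for z
        unfolding q_def using \<open>j \<le> n\<close> that by (intro damp_mult_bounded F(3)) auto
      hence "bounded ((\<lambda>z. q z * x j z) ` disc)" unfolding bounded_iff by blast
      thus ?thesis
        using Hinf_mult_holomorphic[OF q xH[OF that]] by (simp add: Hinf_def)
    qed
    \<comment> \<open>The row vector q x times the adjugate. Multiplying it by A gives q det(A) x,
      so the \<open>U i\<close> are the Cramer coefficients of q det(A) x with respect to the lifted
      \<open>c i\<close>.\<close>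
    define U where "U = (\<lambda>i z. \<Sum>j\<le>n. q z * x j z * b j i z)"
    have U: "U i \<in> Hinf" if "i \<le> n" for i
      unfolding U_def using that by (intro Hinf_sum Hinf_mult[OF qx] b) auto
    have q\<delta>: "(\<lambda>z. q z * ?\<delta> z) \<in> Hinf" by (intro Hinf_mult q \<delta>)
    have fun_eq: "(\<lambda>z. q z * ?\<delta> z * x m z) = (\<lambda>z. \<Sum>i\<le>n. U i z * (A i m z * monom_disc 0 z))" if m: "m \<le> n" for m
    proof
      fix z
      show "q z * ?\<delta> z * x m z = (\<Sum>i\<le>n. U i z * (A i m z * monom_disc 0 z))"
      proof (cases "z \<in> disc")
        case True
        have "(\<Sum>i\<le>n. U i z * (A i m z * monom_disc 0 z)) = (\<Sum>i\<le>n. \<Sum>j\<le>n. q z * x j z * b j i z * A i m z)"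
          using True by (simp add: U_def monom_disc_def sum_distrib_right)
        also have "\<dots> = (\<Sum>j\<le>n. \<Sum>i\<le>n. q z * x j z * b j i z * A i m z)"
          by (rule sum.swap)
        also have "\<dots> = (\<Sum>j\<le>n. q z * x j z * (\<Sum>i\<le>n. b j i z * A i m z))"
          by (simp add: sum_distrib_left mult.assoc)
        also have "\<dots> = (\<Sum>j\<le>n. if j = m then q z * x j z * ?\<delta> z else 0)"
          using m by (intro sum.cong refl) (simp add: b(2))
        also have "\<dots> = q z * ?\<delta> z * x m z" using m by simp
        finally show ?thesis by simp
      next
        case False
        thus ?thesis using H2_outside[OF xH[OF m]] by (simp add: monom_disc_def)
      qed
    qed
    have "uT n \<theta> (\<lambda>z. q z * ?\<delta> z) x = vsum {..n} (\<lambda>i. uT n \<theta> (U i) (c i))"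
    proof (rule DS_eqI)
      show "uT n \<theta> (\<lambda>z. q z * ?\<delta> z) x \<in> DS n \<theta>" by (intro uT_DS q\<delta> D_DS x)
      show "vsum {..n} (\<lambda>i. uT n \<theta> (U i) (c i)) \<in> DS n \<theta>"
        by (intro DS_vsum uT_DS U D_DS c) auto
      fix m assume m: "m \<le> n"
      have "model_cong (\<theta> m) (\<lambda>z. \<Sum>i\<le>n. uT n \<theta> (U i) (c i) m z) (\<lambda>z. \<Sum>i\<le>n. U i z * (A i m z * monom_disc 0 z))"
      proof (rule model_cong_sum)
        fix i assume "i \<in> {..n}"
        hence i: "i \<le> n" by simp
        show "uT n \<theta> (U i) (c i) m \<in> H2" by (intro DS_H2 uT_DS U D_DS c i m)
        show "(\<lambda>z. U i z * (A i m z * monom_disc 0 z)) \<in> H2"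
          by (intro Hinf_mult_H2 U A i m monom_disc_H2)
        show "model_cong (\<theta> m) (uT n \<theta> (U i) (c i) m) (\<lambda>z. U i z * (A i m z * monom_disc 0 z))"
          by (rule model_cong_trans[OF uT_cong[OF U D_DS[OF c]]])
             (use i m in \<open>auto intro!: model_cong_mult inner U Hinf_mult_H2 A monom_disc_H2 cA cH\<close>)
      qed
      hence "model_cong (\<theta> m) (\<lambda>z. q z * ?\<delta> z * x m z) (vsum {..n} (\<lambda>i. uT n \<theta> (U i) (c i)) m)"
        unfolding fun_eq[OF m] vsum_def by (rule model_cong_sym)
      with uT_cong[OF q\<delta> D_DS[OF x] m]
      show "model_cong (\<theta> m) (uT n \<theta> (\<lambda>z. q z * ?\<delta> z) x m) (vsum {..n} (\<lambda>i. uT n \<theta> (U i) (c i)) m)"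
        by (rule model_cong_trans)
    qed
    hence "X (uT n \<theta> (\<lambda>z. q z * ?\<delta> z) x) = X (vsum {..n} (\<lambda>i. uT n \<theta> (U i) (c i)))"
      by simp
    also have "\<dots> = vsum {..n} (\<lambda>i. X (uT n \<theta> (U i) (c i)))"
      by (rule lin_transf_vsum[OF lin, THEN conjunct2]) (auto intro: uT_D U c)
    also have "\<dots> = vsum {..n} (\<lambda>i. uT n \<theta> (U i) (X (c i)))"
      unfolding vsum_def by (simp add: X_uT U c)
    finally have Xeq: "uT n \<theta> (\<lambda>z. q z * ?\<delta> z) (X x) = vsum {..n} (\<lambda>i. uT n \<theta> (U i) (X (c i)))"
      by (simp add: X_uT q\<delta> x)
    have "model_cong (\<theta> k) (vsum {..n} (\<lambda>i. uT n \<theta> (U i) (X (c i))) k) (\<lambda>z. \<Sum>i\<le>n. U i z * X (c i) k z)"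
      unfolding vsum_def
      by (intro model_cong_sum uT_cong DS_H2 uT_DS U X_DS c k Hinf_mult_H2) auto
    with uT_cong[OF q\<delta> X_DS[OF x] k] have "model_cong (\<theta> k) (\<lambda>z. q z * ?\<delta> z * X x k z) (\<lambda>z. \<Sum>i\<le>n. U i z * X (c i) k z)"
      unfolding Xeq by (rule model_cong_trans[OF model_cong_sym])
    hence "model_cong (\<theta> k) (\<lambda>z. g z * (q z * ?\<delta> z * X x k z)) (\<lambda>z. g z * (\<Sum>i\<le>n. U i z * X (c i) k z))"
      by (intro model_cong_mult inner k g Hinf_mult_H2[OF q\<delta>] XH H2_sum Hinf_mult_H2[OF U] XcH) auto
    hence "h2_inner (\<lambda>z. g z * (q z * ?\<delta> z * X x k z)) h = h2_inner (\<lambda>z. g z * (\<Sum>i\<le>n. U i z * X (c i) k z)) h"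
      using h by (simp add: model_cong_def)
    moreover have "(\<lambda>z. g z * (q z * ?\<delta> z * X x k z)) = (\<lambda>z. q z * ?L z)"
      by (simp add: mult_ac)
    \<comment> \<open>The decisive regrouping: x j, so far part of the multiplier acting on X (c i),
      becomes the vector, and g X (c i) k becomes its bounded coefficient. In this form the
      right-hand side depends continuously on \<open>x\<close>.\<close>
    moreover have "g z * (\<Sum>i\<le>n. U i z * X (c i) k z) = q z * ?R z" for z
    proof -
      have "g z * (\<Sum>i\<le>n. U i z * X (c i) k z) = (\<Sum>i\<le>n. \<Sum>j\<le>n. g z * (q z * x j z * b j i z * X (c i) k z))"
        by (simp add: U_def sum_distrib_left sum_distrib_right)
      also have "\<dots> = (\<Sum>j\<le>n. \<Sum>i\<le>n. g z * (q z * x j z * b j i z * X (c i) k z))"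
        by (rule sum.swap)
      also have "\<dots> = q z * ?R z"
        unfolding sum_distrib_left sum_distrib_right by (intro sum.cong refl) (simp add: mult_ac)
      finally show ?thesis .
    qed
    ultimately show ?thesis by (simp add: q_def)
  qed
  \<comment> \<open>Letting s tend to infinity removes q from both sides; g stays.\<close>
  hence "(\<lambda>s. h2_inner (\<lambda>z. damp F (real (Suc s)) z * ?R z) h) \<longlonglongrightarrow> h2_inner ?L h"
    using approx_unit_tendsto[OF au LH hH] by simp
  from LIMSEQ_unique[OF this approx_unit_tendsto[OF au RH hH]] show ?thesis .
qed

text \<open>For fixed bounded g both sides of \<open>transform_formula\<close> are continuous, the
  left one in X x and the right one in x. The formula therefore extends to every point of the graph
  closure, where its right side contains x alone and is the same for y and y'. Finally g is sent to
  1.\<close>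

lemma determinant_identifies_limits:
  assumes "(x, y) \<in> graph_closure (DS n \<theta>) (ds_norm n) D X"
    and "(x, y') \<in> graph_closure (DS n \<theta>) (ds_norm n) D X"
    and k: "k \<le> n"
  shows "model_cong (\<theta> k) (\<lambda>z. fun_det (Suc n) A z * y k z) (\<lambda>z. fun_det (Suc n) A z * y' k z)"
  unfolding model_cong_def
proof
  fix h assume h: "h \<in> model_space (\<theta> k)"
  have hH: "h \<in> H2" by (rule model_space_H2[OF h])
  let ?\<delta> = "fun_det (Suc n) A"
  have \<delta>: "?\<delta> \<in> Hinf" by (intro fun_det_Hinf A) auto
  obtain b where b: "\<And>i j. i \<le> n \<Longrightarrow> j \<le> n \<Longrightarrow> b i j \<in> Hinf"
      "\<And>i j z. i \<le> n \<Longrightarrow> j \<le> n \<Longrightarrow>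
         (\<Sum>k\<le>n. b i k z * A k j z) = (if i = j then fun_det (Suc n) A z else 0)"
    using fun_det_cofactors[of n A, OF A] by blast
  have XcH: "X (c i) k \<in> H2" if "i \<le> n" for i by (rule DS_H2[OF X_DS[OF c[OF that]] k])
  obtain G where G: "G holomorphic_on disc" "\<And>z. z \<in> disc \<Longrightarrow> 0 \<le> Re (G z)"
    "\<And>i z. i \<in> {..n} \<Longrightarrow> z \<in> disc \<Longrightarrow> (cmod (X (c i) k z))\<^sup>2 \<le> Re (G z)"
    "\<And>z. z \<in> ball 0 (1/2) \<Longrightarrow> cmod (G z) \<le> 12 * (\<Sum>i\<in>{..n}. (h2_norm (X (c i) k))\<^sup>2)"
    using Herglotz_majorant_family[of "{..n}" "\<lambda>i. X (c i) k"] XcH by (metis atMost_iff finite_atMost)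
  have au: "approx_unit (\<lambda>s. damp G (real (Suc s)))"
    by (rule approx_unit_damp[OF G(1,2,4)])
  \<comment> \<open>The multiplier must not vary along the approximating sequence: it depends on the
    \<open>X (c i)\<close> and s, while the vectors t l converge to x.\<close>
  have formula: "h2_inner (\<lambda>z. damp G (real (Suc s)) z * (?\<delta> z * w k z)) h =
      h2_inner (\<lambda>z. \<Sum>j\<le>n. (\<Sum>i\<le>n. b j i z * (damp G (real (Suc s)) z * X (c i) k z)) * x j z) h"
    if w: "(x, w) \<in> graph_closure (DS n \<theta>) (ds_norm n) D X" for w s
  proof -
    define g where "g = damp G (real (Suc s))"
    have g: "g \<in> Hinf" unfolding g_def by (rule damp_Hinf[OF G(1,2)]) auto
    have gc: "(\<lambda>z. g z * X (c i) k z) \<in> Hinf" if "i \<le> n" for i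
    proof -
      have "cmod (g z * X (c i) k z) \<le> real (Suc s) + 1" if "z \<in> disc" for z
        unfolding g_def using \<open>i \<le> n\<close> that by (intro damp_mult_bounded G(3)) auto
      hence "bounded ((\<lambda>z. g z * X (c i) k z) ` disc)" unfolding bounded_iff by blast
      thus ?thesis
        using Hinf_mult_holomorphic[OF g XcH[OF that]] by (simp add: Hinf_def)
    qed
    define \<beta> where "\<beta> = (\<lambda>j z. \<Sum>i\<le>n. b j i z * (g z * X (c i) k z))"
    have \<beta>: "\<beta> j \<in> Hinf" if "j \<le> n" for j
      unfolding \<beta>_def using that by (intro Hinf_sum Hinf_mult[OF b(1) gc]) auto
    obtain t where t: "\<And>l. t l \<in> D" "(\<lambda>l. ds_norm n (vsub (t l) x)) \<longlonglongrightarrow> 0"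
        "(\<lambda>l. ds_norm n (vsub (X (t l)) w)) \<longlonglongrightarrow> 0" and xw: "x \<in> DS n \<theta>" "w \<in> DS n \<theta>"
      using w unfolding graph_closure_def by blast
    have tH: "t l j \<in> H2" "X (t l) j \<in> H2" "x j \<in> H2" "w j \<in> H2" if "j \<le> n" for l j
      using DS_H2[OF D_DS[OF t(1)] that] DS_H2[OF X_DS[OF t(1)] that] DS_H2[OF xw(1) that] DS_H2[OF xw(2) that]
      by blast+
    have g\<delta>: "(\<lambda>z. g z * ?\<delta> z) \<in> Hinf" by (intro Hinf_mult g \<delta>)
    have "(\<lambda>l. h2_inner (\<lambda>z. g z * ?\<delta> z * X (t l) k z) h) \<longlonglongrightarrow> h2_inner (\<lambda>z. g z * ?\<delta> z * w k z) h"
      by (intro h2_inner_tendsto Hinf_mult_H2 g\<delta> tH k hH Hinf_mult_tendsto component_tendsto[OF _ xw(2) t(3)] X_DS t(1))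
    moreover have "(\<lambda>l. h2_inner (\<lambda>z. \<Sum>j\<le>n. \<beta> j z * t l j z) h) \<longlonglongrightarrow> h2_inner (\<lambda>z. \<Sum>j\<le>n. \<beta> j z * x j z) h"
    proof -
      have sum_eq: "h2_inner (\<lambda>z. \<Sum>j\<le>n. \<beta> j z * v j z) h = (\<Sum>j\<le>n. h2_inner (\<lambda>z. \<beta> j z * v j z) h)"
        if "\<And>j. j \<le> n \<Longrightarrow> v j \<in> H2" for v
        using that by (intro h2_inner_sum_left Hinf_mult_H2 \<beta> hH) auto
      have "(\<lambda>l. \<Sum>j\<le>n. h2_inner (\<lambda>z. \<beta> j z * t l j z) h) \<longlonglongrightarrow> (\<Sum>j\<le>n. h2_inner (\<lambda>z. \<beta> j z * x j z) h)"
        by (intro tendsto_sum h2_inner_tendsto Hinf_mult_H2 \<beta> tH hH Hinf_mult_tendsto component_tendsto[OF _ xw(1) t(2)] D_DS t(1)) auto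
      thus ?thesis by (simp add: sum_eq tH)
    qed
    moreover have "h2_inner (\<lambda>z. g z * ?\<delta> z * X (t l) k z) h = h2_inner (\<lambda>z. \<Sum>j\<le>n. \<beta> j z * t l j z) h" for l
      using transform_formula[OF b t(1) k g gc h, of l] by (simp add: \<beta>_def mult.assoc)
    ultimately have "h2_inner (\<lambda>z. g z * ?\<delta> z * w k z) h = h2_inner (\<lambda>z. \<Sum>j\<le>n. \<beta> j z * x j z) h"
      by (simp add: LIMSEQ_unique)
    thus ?thesis by (simp add: \<beta>_def g_def mult.assoc)
  qed
  have yH: "y k \<in> H2" "y' k \<in> H2"
    using assms by (auto simp: graph_closure_def intro: DS_H2)
  have "(\<lambda>s. h2_inner (\<lambda>z. damp G (real (Suc s)) z * (?\<delta> z * y k z)) h) \<longlonglongrightarrow> h2_inner (\<lambda>z. ?\<delta> z * y k z) h"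
    "(\<lambda>s. h2_inner (\<lambda>z. damp G (real (Suc s)) z * (?\<delta> z * y' k z)) h) \<longlonglongrightarrow> h2_inner (\<lambda>z. ?\<delta> z * y' k z) h"
    by (intro approx_unit_tendsto au Hinf_mult_H2 \<delta> yH hH)+
  thus "h2_inner (\<lambda>z. ?\<delta> z * y k z) h = h2_inner (\<lambda>z. ?\<delta> z * y' k z) h"
    unfolding formula[OF assms(1)] formula[OF assms(2)] by (rule LIMSEQ_unique)
qed

end

section \<open>Matrices near the identity, and uniqueness of limits\<close>

text \<open>The projection of the i-th constant unit vector is approximated by \<open>d i\<close> in
  D. Adding the error to the unit vector itself gives a lift of \<open>d i\<close> that is close to
  it but possibly unbounded. Multiplying by one v in \<open>Hinf\<close> bounds all entries, and
  \<open>c i\<close>, the image of \<open>d i\<close> under v(T), stays in D by invariance.\<close>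

lemma bounded_approximation:
  assumes "\<epsilon> > 0"
  shows "\<exists>A c. approximant \<epsilon> A c \<and> (\<forall>i\<le>n. c i \<in> D)"
proof -
  define e where "e = (\<lambda>i j. if i = (j::nat) then 1 else (0::complex))"
  have eH: "(\<lambda>z. e i j * monom_disc 0 z) \<in> H2" for i j by (intro H2_cmult monom_disc_H2)
  define p where "p = (\<lambda>i j. if j \<le> n then h2_proj (model_space (\<theta> j)) (\<lambda>z. e i j * monom_disc 0 z) else (\<lambda>z. 0))"
  have pD: "p i \<in> DS n \<theta>" for i
    using h2_proj_model_space(1)[OF inner eH] by (simp add: DS_def p_def)
  have pc: "model_cong (\<theta> j) (p i j) (\<lambda>z. e i j * monom_disc 0 z)" if "j \<le> n" for i j
    using h2_proj_model_space(2)[OF inner eH] that by (simp add: p_def)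
  have "\<forall>i. \<exists>d\<in>D. ds_norm n (vsub (p i) d) < \<epsilon>"
    using comm pD assms unfolding commutes_with_def dense_in_def by blast
  then obtain d where d: "\<And>i. d i \<in> D" "\<And>i. ds_norm n (vsub (p i) (d i)) < \<epsilon>" by metis
  have dH: "d i j \<in> H2" and pH: "p i j \<in> H2" if "j \<le> n" for i j
    using DS_H2[OF D_DS[OF d(1)] that] DS_H2[OF pD that] by blast+
  \<comment> \<open>This is d i j - p i j; the factor -1 keeps the order of subtraction of
    \<open>vsub (p i) (d i)\<close>, whose norm is controlled.\<close>
  define f where "f = (\<lambda>(i, j) z. - 1 * (p i j z - d i j z))"
  have fH: "f w \<in> H2" if "w \<in> {..n} \<times> {..n}" for w
    using that unfolding f_def by (auto intro!: H2_cmult[of _ "-1", simplified] H2_diff pH dH)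
  have fn: "(h2_norm (f w))\<^sup>2 \<le> \<epsilon>\<^sup>2" if wI: "w \<in> {..n} \<times> {..n}" for w
  proof -
    obtain i j where w: "w = (i, j)" "i \<le> n" "j \<le> n" using wI by auto
    have gH: "vsub (p i) (d i) j \<in> H2" unfolding vsub_def by (intro H2_diff pH dH w)
    have "h2_norm (f w) = h2_norm (vsub (p i) (d i) j)"
      unfolding h2_norm_def using tcoeff_cmult[OF H2_holomorphic[OF gH], of "-1"]
      by (simp add: w f_def vsub_def)
    moreover have "(h2_norm (vsub (p i) (d i) j))\<^sup>2 \<le> (ds_norm n (vsub (p i) (d i)))\<^sup>2"
    proof -
      have "(h2_norm (vsub (p i) (d i) j))\<^sup>2 \<le> (\<Sum>j\<le>n. (h2_norm (vsub (p i) (d i) j))\<^sup>2)"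
        by (rule member_le_sum) (use w in auto)
      thus ?thesis by (simp add: ds_norm_def sum_nonneg)
    qed
    moreover have "(ds_norm n (vsub (p i) (d i)))\<^sup>2 \<le> \<epsilon>\<^sup>2"
      using d(2)[of i] by (intro power_mono) (auto simp: ds_norm_def sum_nonneg)
    ultimately show ?thesis by simp
  qed
  obtain F where F: "F holomorphic_on disc" "\<And>z. z \<in> disc \<Longrightarrow> 0 \<le> Re (F z)"
    "\<And>w z. w \<in> {..n} \<times> {..n} \<Longrightarrow> z \<in> disc \<Longrightarrow> (cmod (f w z))\<^sup>2 \<le> Re (F z)"
    "\<And>z. z \<in> ball 0 (1/2) \<Longrightarrow> cmod (F z) \<le> 12 * (\<Sum>w\<in>{..n} \<times> {..n}. (h2_norm (f w))\<^sup>2)"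
    using Herglotz_majorant_family[of "{..n} \<times> {..n}" f] fH by (metis finite_atMost finite_cartesian_product)
  \<comment> \<open>The factor 12 comes from the majorant on the half-radius disc, and there are (n
    + 1)^2 errors, each of squared norm at most \<epsilon>^2.\<close>
  define K where "K = 12 * (real (Suc n))\<^sup>2 * \<epsilon>\<^sup>2"
  have FK: "cmod (F z) \<le> K" if "z \<in> ball 0 (1/2)" for z
  proof -
    have "(\<Sum>w\<in>{..n} \<times> {..n}. (h2_norm (f w))\<^sup>2) \<le> real (card ({..n} \<times> {..n})) * \<epsilon>\<^sup>2"
      by (rule sum_bounded_above[OF fn])
    also have "real (card ({..n} \<times> {..n})) = (real (Suc n))\<^sup>2"
      by (simp only: card_cartesian_product card_atMost of_nat_mult power2_eq_square)
    finally show ?thesis using F(4)[OF that] by (simp add: K_def)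
  qed
  \<comment> \<open>No large s is needed: F is at most \<open>K\<close> on the small disc, so v is
    within \<open>K\<close> of 1 there. The value s = 1 also bounds v f by 2, which with |v| \<le> 1
    gives the bound 3 on the entries.\<close>
  define v where "v = damp F 1"
  have v: "v \<in> Hinf" unfolding v_def by (rule damp_Hinf[OF F(1,2)]) auto
  have v1: "cmod (v z) \<le> 1" if "z \<in> disc" for z
    unfolding v_def by (intro cmod_damp_le_1 F(2) that) simp
  define A where "A = (\<lambda>i j z. v z * (e i j + f (i, j) z))"
  have Ab: "cmod (A i j z) \<le> 3" if "i \<le> n" "j \<le> n" "z \<in> disc" for i j z
  proof -
    have "cmod (v z * f (i, j) z) \<le> 1 + 1"
      using damp_mult_bounded[of "f (i, j) z" F z 1] F(3)[of "(i, j)" z] that by (simp add: v_def)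
    moreover have "cmod (v z * e i j) \<le> 1" using v1[OF that(3)] by (simp add: e_def)
    moreover have "cmod (A i j z) \<le> cmod (v z * e i j) + cmod (v z * f (i, j) z)"
      unfolding A_def distrib_left by (rule norm_triangle_ineq)
    ultimately show ?thesis by linarith
  qed
  have A: "A i j \<in> Hinf" if "i \<le> n" "j \<le> n" for i j
  proof -
    have "f (i, j) \<in> H2" using fH[of "(i, j)"] that by simp
    hence "(\<lambda>z. e i j + f (i, j) z) holomorphic_on disc"
      by (intro holomorphic_intros H2_holomorphic)
    hence "A i j holomorphic_on disc"
      unfolding A_def using v by (intro holomorphic_on_mult) (simp_all add: Hinf_def)
    moreover have "bounded (A i j ` disc)" unfolding bounded_iff using Ab[OF that] by blast
    ultimately show ?thesis by (simp add: Hinf_def)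
  qed
  \<comment> \<open>The two contributions are |v - 1| \<le> |F| \<le> K and |v f| \<le> |f| \<le>
    sqrt K, the latter from |f|^2 \<le> Re F.\<close>
  have near: "cmod (A i j z - e i j) \<le> K + sqrt K" if "i \<le> n" "j \<le> n" "z \<in> ball 0 (1/2)" for i j z
  proof -
    have z: "z \<in> disc" using that by (auto simp: mem_disc)
    have "A i j z - e i j = (v z - 1) * e i j + v z * f (i, j) z" by (simp add: A_def algebra_simps)
    hence "cmod (A i j z - e i j) \<le> cmod ((v z - 1) * e i j) + cmod (v z * f (i, j) z)"
      by (simp only: norm_triangle_ineq)
    also have "cmod ((v z - 1) * e i j) \<le> cmod (v z - 1)" by (simp add: e_def)
    also have "cmod (v z - 1) \<le> cmod (F z) / 1"
      unfolding v_def by (intro damp_minus_1 F(2) z) simp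
    also have "cmod (F z) / 1 \<le> K" using FK[OF that(3)] by simp
    also have "cmod (v z * f (i, j) z) \<le> cmod (f (i, j) z)"
      using v1[OF z] by (simp add: norm_mult mult_left_le_one_le)
    also have "cmod (f (i, j) z) \<le> sqrt K"
    proof (rule real_le_rsqrt)
      have "(cmod (f (i, j) z))\<^sup>2 \<le> Re (F z)" using that z by (intro F(3)) auto
      also have "\<dots> \<le> cmod (F z)" by (rule complex_Re_le_cmod)
      also have "\<dots> \<le> K" by (rule FK[OF that(3)])
      finally show "(cmod (f (i, j) z))\<^sup>2 \<le> K" .
    qed
    finally show ?thesis by simp
  qed
  define c where "c = (\<lambda>i. uT n \<theta> v (d i))"
  have cD: "c i \<in> D" for i unfolding c_def by (intro uT_D v d)
  have cong: "model_cong (\<theta> j) (c i j) (\<lambda>z. A i j z * monom_disc 0 z)" if ij: "i \<le> n" "j \<le> n" for i j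
  proof -
    have fij: "f (i, j) \<in> H2" using fH[of "(i, j)"] ij by simp
    have "model_cong (\<theta> j) (\<lambda>z. p i j z + f (i, j) z) (\<lambda>z. e i j * monom_disc 0 z + f (i, j) z)"
      by (intro model_cong_add pH eH fij pc model_cong_refl ij)
    moreover have "(\<lambda>z. p i j z + f (i, j) z) = d i j" by (simp add: f_def)
    ultimately have "model_cong (\<theta> j) (\<lambda>z. v z * d i j z) (\<lambda>z. v z * (e i j * monom_disc 0 z + f (i, j) z))"
      by (intro model_cong_mult inner v dH H2_add eH fij ij) simp
    moreover have "(\<lambda>z. v z * (e i j * monom_disc 0 z + f (i, j) z)) = (\<lambda>z. A i j z * monom_disc 0 z)"
      using H2_outside[OF fij] by (auto simp: A_def monom_disc_def)
    ultimately have "model_cong (\<theta> j) (\<lambda>z. v z * d i j z) (\<lambda>z. A i j z * monom_disc 0 z)" by simp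
    with uT_cong[OF v D_DS[OF d(1)] ij(2)] show ?thesis
      unfolding c_def by (rule model_cong_trans)
  qed
  show ?thesis
    using A Ab cong near cD unfolding K_def e_def approximant_def by (intro exI[of _ A] exI[of _ c]) auto
qed

text \<open>The determinants form an approximate unit: the entries are bounded by 3, whatever the
  tolerance, and tend uniformly to those of the identity matrix on the small disc. The vectors
  \<open>c m i\<close> change with m, but the identity obtained for each m involves y, y' and the
  determinant alone, so the weak limit can be taken.\<close>

lemma limits_unique:
  assumes xy: "(x, y) \<in> graph_closure (DS n \<theta>) (ds_norm n) D X"
    and xy': "(x, y') \<in> graph_closure (DS n \<theta>) (ds_norm n) D X"
  shows "y = y'"
proof -
  let ?K = "\<lambda>\<epsilon>::real. 12 * (real (Suc n))\<^sup>2 * \<epsilon>\<^sup>2 + sqrt (12 * (real (Suc n))\<^sup>2 * \<epsilon>\<^sup>2)"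
  let ?\<epsilon> = "\<lambda>m. 1 / real (Suc m)"
  obtain A c where A: "\<And>m i j. i \<le> n \<Longrightarrow> j \<le> n \<Longrightarrow> A m i j \<in> Hinf"
      "\<And>m i j z. i \<le> n \<Longrightarrow> j \<le> n \<Longrightarrow> z \<in> disc \<Longrightarrow> cmod (A m i j z) \<le> 3"
      "\<And>m i j. i \<le> n \<Longrightarrow> j \<le> n \<Longrightarrow> model_cong (\<theta> j) (c m i j) (\<lambda>z. A m i j z * monom_disc 0 z)"
      "\<And>m i j z. i \<le> n \<Longrightarrow> j \<le> n \<Longrightarrow> z \<in> ball 0 (1/2) \<Longrightarrow>
         cmod (A m i j z - (if i = j then 1 else 0)) \<le> ?K (?\<epsilon> m)"
      "\<And>m i. i \<le> n \<Longrightarrow> c m i \<in> D"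
  proof -
    have "\<forall>m. \<exists>A c. approximant (?\<epsilon> m) A c \<and> (\<forall>i\<le>n. c i \<in> D)"
      by (intro allI bounded_approximation) simp
    then obtain A c where "\<And>m. approximant (?\<epsilon> m) (A m) (c m)" "\<And>m i. i \<le> n \<Longrightarrow> c m i \<in> D"
      by metis
    thus ?thesis by (intro that[of A c]) (auto simp: approximant_def)
  qed
  let ?\<delta> = "\<lambda>m. fun_det (Suc n) (A m)"
  have Klim: "(\<lambda>m. ?K (?\<epsilon> m)) \<longlonglongrightarrow> 0"
  proof -
    have "?\<epsilon> \<longlonglongrightarrow> 0" by real_asymp
    hence "(\<lambda>m. ?K (?\<epsilon> m)) \<longlonglongrightarrow> ?K 0" by (intro tendsto_intros)
    thus ?thesis by simp
  qed
  have au: "approx_unit ?\<delta>"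
    unfolding approx_unit_def
  proof (intro conjI allI)
    show "?\<delta> m \<in> Hinf" for m by (intro fun_det_Hinf A) auto
    show "\<exists>C. \<forall>m. \<forall>z\<in>disc. cmod (?\<delta> m z) \<le> C"
    proof -
      have "cmod (?\<delta> m z) \<le> fact (Suc n) * 3 ^ Suc n" if "z \<in> disc" for m z
        by (rule fun_det_bound) (use that in \<open>auto intro: A\<close>)
      thus ?thesis by blast
    qed
    show "uniform_limit (ball 0 (1/2)) ?\<delta> (\<lambda>_. 1) sequentially"
    proof (rule fun_det_uniform_limit)
      fix i j assume "i < Suc n" "j < Suc n"
      hence ij: "i \<le> n" "j \<le> n" by auto
      show "uniform_limit (ball 0 (1/2)) (\<lambda>m. A m i j) (\<lambda>_. if i = j then 1 else 0) sequentially"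
      proof (rule uniform_limitI)
        fix e :: real assume "e > 0"
        with Klim have "\<forall>\<^sub>F m in sequentially. ?K (?\<epsilon> m) < e" by (rule order_tendstoD(2))
        thus "\<forall>\<^sub>F m in sequentially. \<forall>z\<in>ball 0 (1/2). dist (A m i j z) (if i = j then 1 else 0) < e"
          by eventually_elim (use A(4)[OF ij] in \<open>auto simp only: dist_norm intro: le_less_trans\<close>)
      qed
    qed
  qed
  have yD: "y \<in> DS n \<theta>" "y' \<in> DS n \<theta>"
    using xy xy' by (auto simp: graph_closure_def)
  show ?thesis
  proof (rule DS_eqI[OF yD])
    fix k assume k: "k \<le> n"
    show "model_cong (\<theta> k) (y k) (y' k)"
      unfolding model_cong_def
    proof
      fix h assume h: "h \<in> model_space (\<theta> k)"
      have eq: "h2_inner (\<lambda>z. ?\<delta> m z * y k z) h = h2_inner (\<lambda>z. ?\<delta> m z * y' k z) h" for m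
        using determinant_identifies_limits[OF A(1) A(5) A(3) xy xy' k] h by (simp add: model_cong_def)
      have "(\<lambda>m. h2_inner (\<lambda>z. ?\<delta> m z * y k z) h) \<longlonglongrightarrow> h2_inner (y k) h"
        "(\<lambda>m. h2_inner (\<lambda>z. ?\<delta> m z * y' k z) h) \<longlonglongrightarrow> h2_inner (y' k) h"
        by (intro approx_unit_tendsto au DS_H2 yD k model_space_H2[OF h])+
      thus "h2_inner (y k) h = h2_inner (y' k) h"
        unfolding eq by (rule LIMSEQ_unique)
    qed
  qed
qed

end

end

theorem theorem5p3:
  fixes n :: nat and \<theta> :: "nat \<Rightarrow> complex \<Rightarrow> complex"
  assumes "\<forall>j\<le>n. inner_fn (\<theta> j) \<and> nonconstant_on_disc (\<theta> j)"
  shows "closability_property (DS n \<theta>) (ds_norm n) {uT n \<theta> u | u. u \<in> Hinf}"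
proof -
  interpret inner_family n \<theta>
    by unfold_locales (use assms in blast)
  show ?thesis
    unfolding closability_property_def closable_def using limits_unique by blast
qed

end
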